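(* Let the guest graph $G=(V,E)$ and the host graph $T$ be binary regular trees of heights $h_G\ge 1$ and $h=h_G+1$, respectively. Then Algorithm $\mathcal{A}$ (described in the context) is a $\frac{203}{200}$-approximation algorithm for $DAPT(G,2)$, i.e. the arrangement $\phi_A$ it computes satisfies $$OV(G,2,\phi_A)\le \frac{203}{200}\, OV(G,2,\phi_* )$$ for every such $G$, where $\phi_*$ denotes an optimal arrangement of $DAPT(G,2)$.
   Context: Binary regular tree: a rooted tree in which all leaves are at the same distance $h$ (the height) from the root and every non-leaf vertex has exactly two children (a left one and a right one); height $0$ means a single vertex. The two basic subtrees of a binary regular tree of height at least $1$ are the subtrees rooted at the left and at the right child of the root. Problem $DAPT(G,2)$: $G=(V,E)$ is a binary regular tree of height $h_G$ (the guest graph) with $2^{h_G+1}-1$ vertices, and $T$ is the binary regular tree of height $h=h_G+1$ (the host graph), with $b=2^{h_G+1}$ leaves. An arrangement is an injective map $\phi$ from $V$ to the set of leaves of $T$. Its objective value is $OV(G,2,\phi)=\sum_{(u,v)\in E} d_T(\phi(u),\phi(v))$, where $d_T$ is the number of edges on the unique path in $T$. An optimal arrangement minimises $OV(G,2,\cdot)$. Orders: the vertices of $G$ are labelled $v_1,\dots,v_n$ in canonical order (level by level from the root, left to right; so $v_1$ is the root, $v_2,v_3$ its left and right child). The leaves of $T$ are labelled $b_1,\dots,b_b$ from left to right, so that the leaves of the left basic subtree of $T$ are $b_1,\dots,b_{b/2}$, and recursively so in every subtree. Algorithm $\mathcal{A}$ (recursive; input $G$ of height $h_G$, output $\phi_A$).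 Put $b=2^{h_G+1}$. If $h_G=0$, set $\phi_A(v_1)=b_1$. If $h_G>0$: (i) apply the algorithm to the left and right basic subtrees of $G$ (of height $h_G-1$), obtaining arrangements $\widehat{\phi}_A^{(1)}$ and $\widehat{\phi}_A^{(2)}$; (ii) arrange the vertices of the left basic subtree on $b_1,\dots,b_{b/2}$ according to $\widehat{\phi}_A^{(1)}$ and those of the right basic subtree on $b_{b/2+1},\dots,b_b$ according to $\widehat{\phi}_A^{(2)}$; (iii) set $\phi_A(v_1)=b_{b/2}$ (this leaf is always free at this point); (iv) if $h_G$ is odd and $h_G\ge 3$, exchange the vertices arranged at the leaves $b_{b/4-1}$ and $b_{b/2}$ (pair-exchange). Return $\phi_A$. *)

theory Defs
  imports
    Complex_Main
    "HOL-Library.Tree"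
    "HOL-Combinatorics.Transposition"
    "Graph_Theory.Digraph_Component"
begin

(* A rooted ordered tree with vertex set inside 'a is an element of 'a tree whose labels, the
   vertices, are pairwise distinct.  The constructor Leaf is the empty tree, not a leaf: a leaf of
   the rooted tree is a node with two empty subtrees, and the library height counts vertices
   rather than edges on a longest branch. *)
definition binary_regular_tree :: "nat \<Rightarrow> 'a tree \<Rightarrow> bool" where
  "binary_regular_tree h t \<longleftrightarrow> Tree.complete t \<and> height t = Suc h \<and> distinct (inorder t)"

(* Every edge occurs exactly once, oriented from parent to child. *)
definition tree_digraph :: "'a tree \<Rightarrow> 'a pair_pre_digraph" where
  "tree_digraph t = \<lparr> pverts = set_tree t,
     parcs = {(v, w) | v w l r l' r'. \<langle>l, v, r\<rangle> \<in> subtrees t \<and> \<langle>l', w, r'\<rangle> \<in> {l, r}} \<rparr>"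

definition tree_dist :: "'a tree \<Rightarrow> 'a \<Rightarrow> 'a \<Rightarrow> nat" where
  "tree_dist t x y =
     length (THE p. pre_digraph.apath (with_proj (mk_symmetric (with_proj (tree_digraph t)))) x p y)"

(* The leaves from left to right. *)
fun leaves :: "'a tree \<Rightarrow> 'a list" where
  "leaves \<langle>\<rangle> = []"
| "leaves \<langle>l, v, r\<rangle> = (if l = \<langle>\<rangle> \<and> r = \<langle>\<rangle> then [v] else leaves l @ leaves r)"

(* The leaf b_i; the numbering starts at 1. *)
definition nth_leaf :: "'a tree \<Rightarrow> nat \<Rightarrow> 'a" where
  "nth_leaf t i = leaves t ! (i - 1)"

(* The values of phi outside the vertex set of G are irrelevant. *)
definition arrangement :: "'a tree \<Rightarrow> 'b tree \<Rightarrow> ('a \<Rightarrow> 'b) \<Rightarrow> bool" where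
  "arrangement G T \<phi> \<longleftrightarrow> inj_on \<phi> (set_tree G) \<and> \<phi> ` set_tree G \<subseteq> set (leaves T)"

definition OV :: "'a tree \<Rightarrow> 'b tree \<Rightarrow> ('a \<Rightarrow> 'b) \<Rightarrow> nat" where
  "OV G T \<phi> = (\<Sum>(u, v)\<in>parcs (tree_digraph G). tree_dist T (\<phi> u) (\<phi> v))"

definition optimal_arrangement :: "'a tree \<Rightarrow> 'b tree \<Rightarrow> ('a \<Rightarrow> 'b) \<Rightarrow> bool" where
  "optimal_arrangement G T \<phi> \<longleftrightarrow> is_arg_min (OV G T) (arrangement G T) \<phi>"

(* The algorithm on leaf indices: vertex x of G goes to the leaf numbered algA_index G x.  In the
   Node equation, h_G is the library height of the left basic subtree.  The empty tree is not a
   valid input. *)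
fun algA_index :: "'a tree \<Rightarrow> 'a \<Rightarrow> nat" where
  "algA_index \<langle>\<rangle> = undefined"
| "algA_index \<langle>l, v, r\<rangle> =
     (let hG = height l; b = 2 ^ (hG + 1) in
      if hG = 0 then (\<lambda>x. 1)
      else
        let \<psi> = (\<lambda>x. if x = v then b div 2
                     else if x \<in> set_tree l then algA_index l x
                     else b div 2 + algA_index r x)
        in if odd hG \<and> hG \<ge> 3
           then transpose (b div 4 - 1) (b div 2) \<circ> \<psi>
           else \<psi>)"

definition algA :: "'a tree \<Rightarrow> 'b tree \<Rightarrow> 'a \<Rightarrow> 'b" where
  "algA G T x = nth_leaf T (algA_index G x)"

end

theory Submission
  imports Defs
begin

text \<open>
  Number the leaves of the host tree from 0 and, for every \<open>j\<close>, cut them into blocks of \<open>2 ^ j\<close>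
  consecutive leaves.  Two leaves are at distance \<open>2 k\<close>, where \<open>k\<close> is the number of levels \<open>j\<close> at
  which they lie in different blocks (\<open>tree_dist_leaves\<close>).  Hence half the objective value is the sum
  over \<open>j = 0, \<dots>, h\<close> of the number of guest edges cut by the blocks of size \<open>2 ^ j\<close>, and each
  level can be estimated on its own.

  Lower bound.  Fix \<open>j \<ge> 1\<close> and mark the guest vertices whose subtree has a number of levels divisible
  by \<open>j + 1\<close>.  Removing them leaves complete trees with at most \<open>j\<close> levels, hence with fewer than
  \<open>2 ^ j\<close> vertices.  So \<open>2 ^ j\<close> vertices without a marked one span a disconnected forest, which has at
  most \<open>2 ^ j - 2\<close> edges, whereas a block with a marked vertex can have \<open>2 ^ j - 1\<close>
  (\<open>inner_edges_block\<close>).  There are \<open>2 ^ (h + 1) div (2 ^ (j + 1) - 1)\<close> marked vertices and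
  \<open>2 ^ (h + 1 - j)\<close> blocks, which bounds the number of uncut edges from above (\<open>cut_edges_bound\<close>).  At
  level 0 all \<open>2 ^ (h + 1) - 2\<close> edges are cut.  Summing over the levels gives
  \<open>6 * 2 ^ h - 6 - 2 h - D\<close> for half the objective value, where \<open>D\<close> is the sum of the numbers of
  marked vertices over \<open>j = 1, \<dots>, h\<close> (\<open>OV_lower_bound\<close>).

  The algorithm. Two copies of the arrangement for height \<open>h\<close> and the two edges at
  the new root cost, in half distances, twice the old cost plus \<open>2 h + 3\<close>
  (\<open>layout_join\<close>), and the pair-exchange saves exactly 1
  (\<open>layout_exchange\<close>): the root becomes a sibling of its left child in the host tree,
  and the vertex that has to make room is a guest leaf, so that only one other edge changes its
  length. Solving the recursion gives \<open>29 / 6 * 2 ^ h - 2 h - 13 / 3\<close> or \<open>29 /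
  6 * 2 ^ h - 2 h - 14 / 3\<close>, depending on the parity of \<open>h\<close>
  (\<open>alg_cost_closed_form\<close>).

  Comparison.  Since \<open>D\<close> is less than \<open>2 ^ (h + 1)\<close> times the sum of \<open>1 / (2 ^ (j + 1) - 1)\<close> over
  \<open>j \<ge> 1\<close>, and this sum is at most \<open>64 / 105\<close>, the leading coefficients are \<open>29 / 6\<close> and at least
  \<open>502 / 105\<close>.  Their ratio is below 1.011, which leaves enough room for the terms of lower order
  when \<open>h \<ge> 6\<close>; the heights \<open>1, \<dots>, 5\<close> are computed (\<open>approximation_ratio\<close>).
\<close>

section \<open>Binary regular trees and their arcs\<close>

lemma binary_regular_tree_0_iff:
  "binary_regular_tree 0 t \<longleftrightarrow> (\<exists>v. t = \<langle>\<langle>\<rangle>, v, \<langle>\<rangle>\<rangle>)"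
  by (cases t) (auto simp: binary_regular_tree_def)

lemma binary_regular_tree_Suc_iff:
  "binary_regular_tree (Suc h) t \<longleftrightarrow> (\<exists>l v r. t = \<langle>l, v, r\<rangle> \<and> binary_regular_tree h l \<and>
     binary_regular_tree h r \<and> v \<notin> set_tree l \<and> v \<notin> set_tree r \<and> set_tree l \<inter> set_tree r = {})"
  by (cases t) (auto simp: binary_regular_tree_def)

lemma binary_regular_tree_induct [consumes 1, case_names single node]:
  assumes "binary_regular_tree h t"
    and "\<And>v. P 0 \<langle>\<langle>\<rangle>, v, \<langle>\<rangle>\<rangle>"
    and "\<And>h l v r. binary_regular_tree h l \<Longrightarrow> binary_regular_tree h r \<Longrightarrow> v \<notin> set_tree l \<Longrightarrow>
      v \<notin> set_tree r \<Longrightarrow> set_tree l \<inter> set_tree r = {} \<Longrightarrow> P h l \<Longrightarrow> P h r \<Longrightarrow> P (Suc h) \<langle>l, v, r\<rangle>"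
  shows "P h t"
  using assms(1)
proof (induction h arbitrary: t)
  case 0
  then show ?case using assms(2) by (auto simp: binary_regular_tree_0_iff)
next
  case (Suc h)
  then obtain l v r where "t = \<langle>l, v, r\<rangle>" "binary_regular_tree h l" "binary_regular_tree h r"
    "v \<notin> set_tree l" "v \<notin> set_tree r" "set_tree l \<inter> set_tree r = {}"
    unfolding binary_regular_tree_Suc_iff by blast
  then show ?case using assms(3) Suc.IH by simp
qed

lemma binary_regular_tree_not_empty:
  assumes "binary_regular_tree h t"
  shows "t \<noteq> \<langle>\<rangle>" "value t \<in> set_tree t" "height t = Suc h"
proof -
  have h: "height t = Suc h" using assms by (simp add: binary_regular_tree_def)
  then obtain l v r where "t = \<langle>l, v, r\<rangle>" by (cases t) auto
  then show "t \<noteq> \<langle>\<rangle>" "value t \<in> set_tree t" "height t = Suc h" using h by auto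
qed

lemma leaves_Node:
  assumes "binary_regular_tree h l" shows "leaves \<langle>l, v, r\<rangle> = leaves l @ leaves r"
  using binary_regular_tree_not_empty(1)[OF assms] by simp

lemma leaves_regular:
  assumes "binary_regular_tree h t"
  shows "length (leaves t) = 2 ^ h" "set (leaves t) \<subseteq> set_tree t" "distinct (leaves t)"
proof -
  have "length (leaves t) = 2 ^ h \<and> set (leaves t) \<subseteq> set_tree t \<and> distinct (leaves t)"
    using assms
  proof (induction rule: binary_regular_tree_induct)
    case (node h l v r)
    show ?case unfolding leaves_Node[OF node(1)] using node by auto
  qed auto
  then show "length (leaves t) = 2 ^ h" "set (leaves t) \<subseteq> set_tree t" "distinct (leaves t)" by auto
qed

lemma parcs_Leaf: "parcs (tree_digraph \<langle>\<rangle>) = {}"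
  by (simp add: tree_digraph_def)

lemma parcs_iff:
  "(a, w) \<in> parcs (tree_digraph t) \<longleftrightarrow>
     (\<exists>l r. \<langle>l, a, r\<rangle> \<in> subtrees t \<and> (\<exists>l' r'. \<langle>l', w, r'\<rangle> \<in> {l, r}))"
  unfolding tree_digraph_def by simp

text \<open>
  The children are described through their trees rather than through \<^const>\<open>value\<close>, so that the
  equation also covers nodes with an empty subtree.
\<close>
lemma parcs_Node_children:
  "parcs (tree_digraph \<langle>l, v, r\<rangle>) =
     {(v, w) | w l' r'. \<langle>l', w, r'\<rangle> \<in> {l, r}} \<union>
     parcs (tree_digraph l) \<union> parcs (tree_digraph r)"
proof -
  have "(a, w) \<in> parcs (tree_digraph \<langle>l, v, r\<rangle>) \<longleftrightarrow>
     (a, w) \<in> {(v, w) | w l' r'. \<langle>l', w, r'\<rangle> \<in> {l, r}} \<or>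
     (a, w) \<in> parcs (tree_digraph l) \<or> (a, w) \<in> parcs (tree_digraph r)" for a w
    unfolding parcs_iff subtrees.simps Un_iff conj_disj_distribR ex_disj_distrib by simp
  then show ?thesis by auto
qed

lemma parcs_subset: "parcs (tree_digraph t) \<subseteq> set_tree t \<times> set_tree t"
proof (induction t)
  case (Node l v r)
  have "w \<in> set_tree l \<union> set_tree r" if "\<langle>l', w, r'\<rangle> \<in> {l, r}" for l' w r'
    using that by auto
  then show ?case using Node unfolding parcs_Node_children by fastforce
qed (simp add: parcs_Leaf)

lemma parcs_single: "parcs (tree_digraph \<langle>\<langle>\<rangle>, v, \<langle>\<rangle>\<rangle>) = {}"
  by (simp add: parcs_Node_children parcs_Leaf)

lemma parcs_Node:
  assumes "binary_regular_tree h l" "binary_regular_tree h r"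
  shows "parcs (tree_digraph \<langle>l, v, r\<rangle>) =
     {(v, value l), (v, value r)} \<union> parcs (tree_digraph l) \<union> parcs (tree_digraph r)"
proof -
  have "{(v, w) | w l' r'. \<langle>l', w, r'\<rangle> \<in> {l, r}} = {(v, value l), (v, value r)}"
  proof -
    obtain l1 w l2 where "l = \<langle>l1, w, l2\<rangle>"
      using binary_regular_tree_not_empty(1)[OF assms(1)] by (cases l) auto
    moreover obtain r1 u r2 where "r = \<langle>r1, u, r2\<rangle>"
      using binary_regular_tree_not_empty(1)[OF assms(2)] by (cases r) auto
    ultimately show ?thesis by auto
  qed
  then show ?thesis unfolding parcs_Node_children by simp
qed

lemma finite_parcs: "finite (parcs (tree_digraph t))"
  by (rule finite_subset[OF parcs_subset]) simp

lemma sum_parcs_Node: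
  assumes "binary_regular_tree h l" "binary_regular_tree h r"
    "v \<notin> set_tree l" "v \<notin> set_tree r" "set_tree l \<inter> set_tree r = {}"
  shows "(\<Sum>e\<in>parcs (tree_digraph \<langle>l, v, r\<rangle>). f e) =
     f (v, value l) + f (v, value r) + (\<Sum>e\<in>parcs (tree_digraph l). f e) +
     (\<Sum>e\<in>parcs (tree_digraph r). f e :: nat)"
proof -
  have "value l \<noteq> value r"
    using assms(5) binary_regular_tree_not_empty(2)[OF assms(1)]
      binary_regular_tree_not_empty(2)[OF assms(2)] by auto
  moreover have "parcs (tree_digraph l) \<inter> parcs (tree_digraph r) = {}"
    "{(v, value l), (v, value r)} \<inter> (parcs (tree_digraph l) \<union> parcs (tree_digraph r)) = {}"
    using assms(3-5) by (auto dest!: subsetD[OF parcs_subset])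
  ultimately show ?thesis
    unfolding parcs_Node[OF assms(1,2)] Un_assoc
    by (simp add: sum.union_disjoint finite_parcs)
qed

section \<open>Levels at which two leaves are separated\<close>

text \<open>
  For \<open>i, k < 2 ^ h\<close> this is the height of the lowest common ancestor of the leaves number \<open>i\<close> and \<open>k\<close>
  (counted from 0) of a tree of height \<open>h\<close>, written as a sum over the levels because the lower bound
  treats every level separately.
\<close>
definition levels_apart :: "nat \<Rightarrow> nat \<Rightarrow> nat \<Rightarrow> nat" where
  "levels_apart h i k = (\<Sum>j<h. of_bool (i div 2 ^ j \<noteq> k div 2 ^ j))"

lemma levels_apart_same_half:
  assumes "i < 2 ^ h" "k < 2 ^ h"
  shows "levels_apart (Suc h) i k = levels_apart h i k"
    "levels_apart (Suc h) (2 ^ h + i) (2 ^ h + k) = levels_apart h i k"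
proof -
  have *: "(2 ^ h + n) div 2 ^ j = 2 ^ (h - j) + n div 2 ^ j" if "j \<le> h" for n j :: nat
  proof -
    have "2 ^ h = 2 ^ (h - j) * (2::nat) ^ j" using that by (simp flip: power_add)
    then show ?thesis by simp
  qed
  show "levels_apart (Suc h) i k = levels_apart h i k"
    "levels_apart (Suc h) (2 ^ h + i) (2 ^ h + k) = levels_apart h i k"
    using assms by (auto simp: levels_apart_def * intro!: sum.cong)
qed

lemma levels_apart_commute: "levels_apart h i k = levels_apart h k i"
  by (simp add: levels_apart_def eq_commute)

text \<open>
  Blocks of one level are unions of blocks of the level below.  Two numbers that are separated by
  the block boundary \<open>2 ^ h\<close> are therefore apart on all levels up to \<open>h\<close>.
\<close>
lemma levels_apart_halves:
  assumes "i < 2 ^ h" "2 ^ h \<le> k"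
  shows "levels_apart (Suc h) i k = Suc h"
proof -
  have "i div 2 ^ j \<noteq> k div 2 ^ j" if "j < Suc h" for j
  proof
    assume eq: "i div 2 ^ j = k div 2 ^ j"
    have *: "2 ^ h = 2 ^ j * (2::nat) ^ (h - j)" using that by (simp flip: power_add)
    have "n div 2 ^ h = n div 2 ^ j div 2 ^ (h - j)" for n :: nat
      unfolding * by (rule div_mult2_eq)
    then have "i div 2 ^ h = k div 2 ^ h" using eq by simp
    then show False using assms by (simp add: div_eq_0_iff)
  qed
  then show ?thesis by (simp add: levels_apart_def)
qed

section \<open>Distances in the host tree\<close>

text \<open>
  The vertices of a walk are its start and the heads of its arcs, so distinctness can be
  expressed along the recursion.  The arc set is a parameter because trees are assembled from their
  subtrees by adding arcs.
\<close>
fun simple_walk :: "('a \<times> 'a) set \<Rightarrow> 'a \<Rightarrow> ('a \<times> 'a) list \<Rightarrow> 'a \<Rightarrow> bool" where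
  "simple_walk S x [] y \<longleftrightarrow> x = y"
| "simple_walk S x (e # p) y \<longleftrightarrow>
     e \<in> S \<and> fst e = x \<and> x \<notin> snd ` set (e # p) \<and> simple_walk S (snd e) p y"

text \<open>
  The arcs \<open>S\<close> make \<open>A\<close> a tree with metric \<open>d\<close>.  Uniqueness is part of the notion because
  \<^const>\<open>tree_dist\<close> is the length of a definite description.
\<close>
definition unique_walks :: "'a set \<Rightarrow> ('a \<times> 'a) set \<Rightarrow> ('a \<Rightarrow> 'a \<Rightarrow> nat) \<Rightarrow> bool" where
  "unique_walks A S d \<longleftrightarrow> S \<subseteq> A \<times> A \<and>
     (\<forall>x\<in>A. \<forall>y\<in>A. \<exists>p. length p = d x y \<and> (\<forall>q. simple_walk S x q y \<longleftrightarrow> q = p))"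

lemma simple_walk_mono: "simple_walk S x p y \<Longrightarrow> S \<subseteq> S' \<Longrightarrow> simple_walk S' x p y"
  by (induction p arbitrary: x) auto

lemma simple_walk_visits: "simple_walk S x p y \<Longrightarrow> S \<subseteq> A \<times> A \<Longrightarrow> snd ` set p \<subseteq> A"
  by (induction p arbitrary: x) auto

text \<open>
  Here \<open>a\<close> is the only gate into \<open>A\<close>.
\<close>
lemma walk_back_visits:
  assumes "simple_walk S x p y" "x \<notin> A" "y \<in> A" "\<And>u w. (u, w) \<in> S \<Longrightarrow> u \<notin> A \<Longrightarrow> w \<in> A \<Longrightarrow> w = a"
  shows "a \<in> snd ` set p"
  using assms
proof (induction p arbitrary: x)
  case (Cons e p)
  show ?case
  proof (cases "snd e \<in> A")
    case True
    then have "snd e = a" using Cons.prems by (cases e) auto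
    then show ?thesis by auto
  next
    case False
    then have "a \<in> snd ` set p" using Cons by auto
    then show ?thesis by auto
  qed
qed auto

text \<open>
  Two disjoint arc sets are connected by a bridge between \<open>a\<close> and \<open>b\<close>.  A walk that leaves \<open>A\<close> does so
  from \<open>a\<close>, and it can come back only to \<open>a\<close>, which a simple walk does not visit twice.
\<close>
lemma simple_walk_stays:
  assumes "simple_walk (S1 \<union> S2 \<union> {(a, b), (b, a)}) x p y"
    and "x \<in> A" "y \<in> A" "S1 \<subseteq> A \<times> A" "S2 \<subseteq> B \<times> B" "A \<inter> B = {}" "a \<in> A" "b \<in> B"
  shows "simple_walk S1 x p y"
  using assms
proof (induction p arbitrary: x)
  case (Cons e p)
  let ?S = "S1 \<union> S2 \<union> {(a, b), (b, a)}"
  obtain z where e: "e = (x, z)" using Cons.prems(1) by (cases e) auto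
  have w: "simple_walk ?S z p y" "(x, z) \<in> ?S" "x \<notin> snd ` set p" "x \<noteq> z"
    using Cons.prems(1) e by auto
  have "z \<in> A"
  proof (rule ccontr)
    assume z: "z \<notin> A"
    then have "x = a" using w Cons.prems by auto
    moreover have "a \<in> snd ` set p"
      using walk_back_visits[OF w(1) z \<open>y \<in> A\<close>, of a] Cons.prems by blast
    ultimately show False using w by simp
  qed
  then have "simple_walk S1 z p y" using Cons.IH[OF w(1)] Cons.prems by blast
  moreover have "(x, z) \<in> S1" using w \<open>z \<in> A\<close> Cons.prems by auto
  ultimately show ?case using w e by auto
qed auto

text \<open>
  Behind the bridge the previous lemma applies with the two sides interchanged, so the bridge is
  crossed exactly once.
\<close>
lemma simple_walk_crosses:
  assumes "simple_walk (S1 \<union> S2 \<union> {(a, b), (b, a)}) x p y"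
    and "x \<in> A" "y \<in> B" "S1 \<subseteq> A \<times> A" "S2 \<subseteq> B \<times> B" "A \<inter> B = {}" "a \<in> A" "b \<in> B"
  shows "\<exists>p1 p2. p = p1 @ (a, b) # p2 \<and> simple_walk S1 x p1 a \<and> simple_walk S2 b p2 y"
  using assms
proof (induction p arbitrary: x)
  case (Cons e p)
  let ?S = "S1 \<union> S2 \<union> {(a, b), (b, a)}"
  obtain z where e: "e = (x, z)" using Cons.prems(1) by (cases e) auto
  have w: "simple_walk ?S z p y" "(x, z) \<in> ?S" "x \<notin> snd ` set p" "x \<noteq> z"
    using Cons.prems(1) e by auto
  show ?case
  proof (cases "z \<in> A")
    case True
    then obtain p1 p2 where p: "p = p1 @ (a, b) # p2" "simple_walk S1 z p1 a" "simple_walk S2 b p2 y"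
      using Cons.IH[OF w(1)] Cons.prems by blast
    have "(x, z) \<in> S1" using w True Cons.prems by auto
    then have "simple_walk S1 x ((x, z) # p1) a" using p w by auto
    then show ?thesis using p e by (metis append_Cons)
  next
    case False
    then have xz: "x = a" "z = b" using w Cons.prems by auto
    have "?S = S2 \<union> S1 \<union> {(b, a), (a, b)}" by auto
    then have "simple_walk S2 b p y"
      using simple_walk_stays[of S2 S1 b a b p y B A] w(1) xz Cons.prems by auto
    then show ?thesis using e xz by (intro exI[of _ "[]"] exI[of _ p]) auto
  qed
qed auto

lemma simple_walk_append:
  assumes "simple_walk S x p1 z" "simple_walk S z p2 y" "insert x (snd ` set p1) \<inter> snd ` set p2 = {}"
  shows "simple_walk S x (p1 @ p2) y"
  using assms by (induction p1 arbitrary: x) (auto simp: image_iff)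

text \<open>
  Connecting two trees by one edge gives a tree again.  This is the only step from which the tree
  metric is computed: a node is connected with its left subtree and the result with the right one.
\<close>
lemma unique_walks_join:
  assumes A: "unique_walks A S1 d1" and B: "unique_walks B S2 d2"
    and disj: "A \<inter> B = {}" and ab: "a \<in> A" "b \<in> B"
  shows "unique_walks (A \<union> B) (S1 \<union> S2 \<union> {(a, b), (b, a)})
    (\<lambda>x y. if x \<in> A then if y \<in> A then d1 x y else d1 x a + 1 + d2 b y
           else if y \<in> A then d2 x b + 1 + d1 a y else d2 x y)"
    (is "unique_walks _ ?S _")
proof -
  have S: "S1 \<subseteq> A \<times> A" "S2 \<subseteq> B \<times> B" using A B by (auto simp: unique_walks_def)
  have sym: "?S = S2 \<union> S1 \<union> {(b, a), (a, b)}" by auto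
  have same: "simple_walk ?S x q y \<longleftrightarrow> simple_walk S1 x q y" if "x \<in> A" "y \<in> A" for x q y
    using that simple_walk_stays[of S1 S2 a b x q y A B] S disj ab simple_walk_mono[of S1 x q y ?S]
    by blast
  have same': "simple_walk ?S x q y \<longleftrightarrow> simple_walk S2 x q y" if "x \<in> B" "y \<in> B" for x q y
    using that simple_walk_stays[of S2 S1 b a x q y B A] S disj ab simple_walk_mono[of S2 x q y ?S]
    unfolding sym by blast
  \<comment> \<open>Stated for arbitrary parameters, since it is needed for both directions across the bridge.\<close>
  have cross: "\<exists>p. length p = d1 x a + 1 + d2 b y \<and> (\<forall>q. simple_walk (S1 \<union> S2 \<union> {(a, b), (b, a)}) x q y \<longleftrightarrow> q = p)"
    if A: "unique_walks A S1 d1" and B: "unique_walks B S2 d2"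
    and disj: "A \<inter> B = {}" and ab: "a \<in> A" "b \<in> B" and xy: "x \<in> A" "y \<in> B"
    for x y a b :: 'a and A S1 d1 B S2 d2
  proof -
    have S: "S1 \<subseteq> A \<times> A" "S2 \<subseteq> B \<times> B" using A B by (auto simp: unique_walks_def)
    let ?S = "S1 \<union> S2 \<union> {(a, b), (b, a)}"
    obtain p1 where p1: "length p1 = d1 x a" "\<And>q. simple_walk S1 x q a \<longleftrightarrow> q = p1"
      using A xy ab unfolding unique_walks_def by metis
    obtain p2 where p2: "length p2 = d2 b y" "\<And>q. simple_walk S2 b q y \<longleftrightarrow> q = p2"
      using B xy ab unfolding unique_walks_def by metis
    have v: "snd ` set p1 \<subseteq> A" "snd ` set p2 \<subseteq> B"
      using simple_walk_visits p1(2) p2(2) S by metis+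
    have "simple_walk ?S b p2 y" "simple_walk ?S x p1 a"
      using p2(2) p1(2) simple_walk_mono[of S2 b p2 y ?S] simple_walk_mono[of S1 x p1 a ?S] by blast+
    then have "simple_walk ?S x (p1 @ (a, b) # p2) y"
      using v disj ab xy by (intro simple_walk_append[of _ _ _ a]) auto
    moreover have "q = p1 @ (a, b) # p2" if "simple_walk ?S x q y" for q
      using simple_walk_crosses[OF that xy S disj ab] p1(2) p2(2) by auto
    ultimately have "\<forall>q. simple_walk ?S x q y \<longleftrightarrow> q = p1 @ (a, b) # p2" by metis
    moreover have "length (p1 @ (a, b) # p2) = d1 x a + 1 + d2 b y" using p1(1) p2(1) by simp
    ultimately show ?thesis by blast
  qed
  show ?thesis
    unfolding unique_walks_def
  proof (intro conjI ballI)
    show "?S \<subseteq> (A \<union> B) \<times> (A \<union> B)" using S ab by auto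
    fix x y assume xy: "x \<in> A \<union> B" "y \<in> A \<union> B"
    consider "x \<in> A" "y \<in> A" | "x \<in> B" "y \<in> B" "x \<notin> A" "y \<notin> A" | "x \<in> A" "y \<in> B" "y \<notin> A"
      | "x \<in> B" "y \<in> A" "x \<notin> A"
      using xy disj by blast
    then show "\<exists>p. length p = (if x \<in> A then if y \<in> A then d1 x y else d1 x a + 1 + d2 b y
           else if y \<in> A then d2 x b + 1 + d1 a y else d2 x y) \<and>
         (\<forall>q. simple_walk ?S x q y \<longleftrightarrow> q = p)"
    proof cases
      case 1 then show ?thesis using A unfolding same[OF 1] by (simp add: unique_walks_def)
    next
      case 2 then show ?thesis using B unfolding same'[OF 2(1,2)] by (simp add: unique_walks_def)
    next
      case 3 then show ?thesis using cross[OF A B disj ab 3(1,2)] by simp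
    next
      case 4
      have "B \<inter> A = {}" using disj by auto
      then show ?thesis using cross[OF B A _ ab(2,1) 4(1,2)] 4 by (simp only: sym) simp
    qed
  qed
qed

lemma apath_iff_simple_walk:
  fixes D :: "'a pair_pre_digraph"
  shows "pre_digraph.apath (with_proj D) x p y \<longleftrightarrow> x \<in> pverts D \<and> simple_walk (parcs D) x p y"
proof -
  have verts: "pre_digraph.cas (with_proj D) x p y \<Longrightarrow>
      set (pre_digraph.awalk_verts (with_proj D) x p) = insert x (snd ` set p)" for x p
    by (induction p arbitrary: x) (auto simp: pre_digraph.cas.simps pre_digraph.awalk_verts.simps)
  have "set p \<subseteq> parcs D \<and> pre_digraph.cas (with_proj D) x p y \<and>
      distinct (pre_digraph.awalk_verts (with_proj D) x p) \<longleftrightarrow> simple_walk (parcs D) x p y"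
  proof (induction p arbitrary: x)
    case (Cons e p)
    show ?case
      unfolding simple_walk.simps Cons.IH[symmetric]
      by (simp add: pre_digraph.cas.simps pre_digraph.awalk_verts.simps cong: conj_cong)
         (auto simp: verts image_iff, metis snd_conv)
  qed (auto simp: pre_digraph.cas.simps pre_digraph.awalk_verts.simps)
  then show ?thesis
    by (auto simp: pre_digraph.apath_def pre_digraph.awalk_def)
qed

definition sym_arcs :: "'a tree \<Rightarrow> ('a \<times> 'a) set" where
  "sym_arcs t = parcs (tree_digraph t) \<union> (parcs (tree_digraph t))\<inverse>"

lemma tree_dist_eqI:
  assumes "unique_walks (set_tree t) (sym_arcs t) d" "x \<in> set_tree t" "y \<in> set_tree t"
  shows "tree_dist t x y = d x y"
proof -
  let ?D = "mk_symmetric (with_proj (tree_digraph t))"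
  have D: "pverts ?D = set_tree t" "pverts (tree_digraph t) = set_tree t" "parcs ?D = sym_arcs t"
    by (simp_all add: tree_digraph_def[THEN arg_cong[of _ _ pverts]]) (auto simp: parcs_mk_symmetric sym_arcs_def)
  obtain p where "length p = d x y" "\<And>q. simple_walk (sym_arcs t) x q y \<longleftrightarrow> q = p"
    using assms unfolding unique_walks_def by metis
  then show ?thesis
    using assms(2) by (simp add: tree_dist_def apath_iff_simple_walk D)
qed

lemma unique_walks_single: "unique_walks {v} {} (\<lambda>_ _. 0)"
proof -
  have "simple_walk {} v q v \<longleftrightarrow> q = []" for q by (cases q) auto
  then show ?thesis by (auto simp: unique_walks_def)
qed

text \<open>
  Leaves in different subtrees of a node are connected through the two roots and the node.  The
  induction therefore also needs the distances between the leaves and the root, which are all equal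
  to the height.
\<close>
lemma unique_walks_tree:
  assumes "binary_regular_tree h t"
  shows "\<exists>d. unique_walks (set_tree t) (sym_arcs t) d \<and>
    (\<forall>i < 2 ^ h. d (leaves t ! i) (value t) = h \<and> d (value t) (leaves t ! i) = h) \<and>
    (\<forall>i < 2 ^ h. \<forall>k < 2 ^ h. d (leaves t ! i) (leaves t ! k) = 2 * levels_apart h i k)"
  using assms
proof (induction rule: binary_regular_tree_induct)
  case (single v)
  then show ?case
    using unique_walks_single[of v]
    by (intro exI[of _ "\<lambda>_ _. 0"]) (auto simp: sym_arcs_def parcs_single levels_apart_def)
next
  case (node h l v r)
  obtain d1 where d1: "unique_walks (set_tree l) (sym_arcs l) d1"
    "\<And>i. i < 2 ^ h \<Longrightarrow> d1 (leaves l ! i) (value l) = h \<and> d1 (value l) (leaves l ! i) = h"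
    "\<And>i k. i < 2 ^ h \<Longrightarrow> k < 2 ^ h \<Longrightarrow> d1 (leaves l ! i) (leaves l ! k) = 2 * levels_apart h i k"
    using node.IH(1) by blast
  obtain d2 where d2: "unique_walks (set_tree r) (sym_arcs r) d2"
    "\<And>i. i < 2 ^ h \<Longrightarrow> d2 (leaves r ! i) (value r) = h \<and> d2 (value r) (leaves r ! i) = h"
    "\<And>i k. i < 2 ^ h \<Longrightarrow> k < 2 ^ h \<Longrightarrow> d2 (leaves r ! i) (leaves r ! k) = 2 * levels_apart h i k"
    using node.IH(2) by blast
  have roots: "value l \<in> set_tree l" "value r \<in> set_tree r"
    using node.hyps binary_regular_tree_not_empty(2) by auto
  note leaves.simps(2) [simp del]
  note lj = unique_walks_join[OF d1(1) unique_walks_single[of v] _ roots(1) singletonI]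
  define d' where "d' = (\<lambda>x y. if x \<in> set_tree l then if y \<in> set_tree l then d1 x y
      else d1 x (value l) + 1 + 0 else if y \<in> set_tree l then 0 + 1 + d1 (value l) y else (0::nat))"
  have d': "unique_walks (set_tree l \<union> {v}) (sym_arcs l \<union> {} \<union> {(value l, v), (v, value l)}) d'"
    unfolding d'_def using lj node.hyps by blast
  have disj: "(set_tree l \<union> {v}) \<inter> set_tree r = {}" using node.hyps by blast
  note rj = unique_walks_join[OF d' d2(1) disj _ roots(2), of v]
  have sets: "set_tree \<langle>l, v, r\<rangle> = set_tree l \<union> {v} \<union> set_tree r"
    "sym_arcs \<langle>l, v, r\<rangle> = sym_arcs l \<union> {} \<union> {(value l, v), (v, value l)} \<union> sym_arcs r \<union> {(v, value r), (value r, v)}"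
    using parcs_Node[OF node.hyps(1,2), of v] by (auto simp: sym_arcs_def)
  have mem_l: "leaves l ! i \<in> set_tree l" if "i < 2 ^ h" for i
    using leaves_regular[OF node.hyps(1)] that by (metis nth_mem subsetD)
  have mem_r: "leaves r ! i \<in> set_tree r" if "i < 2 ^ h" for i
    using leaves_regular[OF node.hyps(2)] that by (metis nth_mem subsetD)
  have not_l: "x \<notin> set_tree l" "x \<noteq> v" if "x \<in> set_tree r" for x using that node.hyps by auto
  have not_v: "x \<noteq> v" if "x \<in> set_tree l" for x using that node.hyps by auto
  have len: "length (leaves l) = 2 ^ h" using leaves_regular[OF node.hyps(1)] by simp
  have left: "leaves \<langle>l, v, r\<rangle> ! i = leaves l ! i" if "i < 2 ^ h" for i
    unfolding leaves_Node[OF node.hyps(1)] using that len by (simp add: nth_append)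
  have right: "leaves \<langle>l, v, r\<rangle> ! (2 ^ h + i) = leaves r ! i" for i
    unfolding leaves_Node[OF node.hyps(1)] using len by (metis nth_append_length_plus)
  have split: "(\<exists>i'<2 ^ h. i = 2 ^ h + i')" if "\<not> i < 2 ^ h" "i < 2 ^ Suc h" for i :: nat
    using that by (intro exI[of _ "i - 2 ^ h"]) auto
  define d where "d = (\<lambda>x y. if x \<in> set_tree l \<union> {v} then if y \<in> set_tree l \<union> {v} then d' x y
       else d' x v + 1 + d2 (value r) y
     else if y \<in> set_tree l \<union> {v} then d2 x (value r) + 1 + d' v y else d2 x y)"
  have "unique_walks (set_tree \<langle>l, v, r\<rangle>) (sym_arcs \<langle>l, v, r\<rangle>) d"
    unfolding sets d_def using rj by blast
  moreover have "d (leaves \<langle>l, v, r\<rangle> ! i) v = Suc h \<and> d v (leaves \<langle>l, v, r\<rangle> ! i) = Suc h"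
    if i: "i < 2 ^ Suc h" for i
  proof (cases "i < 2 ^ h")
    case True
    then show ?thesis
      using node.hyps mem_l[OF True] not_v[OF mem_l[OF True]] d1(2)[OF True] by (simp add: d_def d'_def left)
  next
    case False
    then obtain i' where i': "i = 2 ^ h + i'" "i' < 2 ^ h" using split[OF False i] by blast
    then show ?thesis
      using node.hyps not_l[OF mem_r[OF i'(2)]] d2(2)[OF i'(2)] unfolding i'(1) right by (simp add: d_def d'_def)
  qed
  moreover have "d (leaves \<langle>l, v, r\<rangle> ! i) (leaves \<langle>l, v, r\<rangle> ! k) = 2 * levels_apart (Suc h) i k"
    if ik: "i < 2 ^ Suc h" "k < 2 ^ Suc h" for i k
  proof -
    consider "i < 2 ^ h" "k < 2 ^ h" | k' where "i < 2 ^ h" "k = 2 ^ h + k'" "k' < 2 ^ h"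
      | i' where "i = 2 ^ h + i'" "i' < 2 ^ h" "k < 2 ^ h"
      | i' k' where "i = 2 ^ h + i'" "i' < 2 ^ h" "k = 2 ^ h + k'" "k' < 2 ^ h"
      using ik split by metis
    then show ?thesis
    proof cases
      case 1
      then show ?thesis
        using mem_l d1(3) by (simp add: d_def left d'_def levels_apart_same_half)
    next
      case 2
      then show ?thesis
        using mem_l[of i] not_v[OF mem_l[of i]] not_l[OF mem_r[OF 2(3)]] d1(2) d2(2) node.hyps levels_apart_halves[of i h k]
        by (simp add: d_def left right d'_def)
    next
      case 3
      then show ?thesis
        using mem_l[of k] not_v[OF mem_l[of k]] not_l[OF mem_r[OF 3(2)]] d1(2) d2(2) node.hyps
          levels_apart_halves[of k h i] levels_apart_commute[of "Suc h" i k]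
        by (simp add: d_def left right d'_def)
    next
      case 4
      then show ?thesis
        using not_l[OF mem_r[OF 4(2)]] not_l[OF mem_r[OF 4(4)]] d2(3)
        by (simp add: d_def right levels_apart_same_half)
    qed
  qed
  ultimately show ?case unfolding tree.sel by blast
qed

lemma tree_dist_leaves:
  assumes "binary_regular_tree h t" "i < 2 ^ h" "k < 2 ^ h"
  shows "tree_dist t (leaves t ! i) (leaves t ! k) = 2 * levels_apart h i k"
proof -
  have "leaves t ! i \<in> set_tree t" "leaves t ! k \<in> set_tree t"
    using leaves_regular[OF assms(1)] assms(2,3) by (metis nth_mem subsetD)+
  then show ?thesis
    using unique_walks_tree[OF assms(1)] tree_dist_eqI assms(2,3) by metis
qed

text \<open>
  This reduces objective values to arithmetic with the numbers of the leaves, counted from 0.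
\<close>
lemma OV_positions:
  fixes p :: "'a \<Rightarrow> nat"
  assumes "binary_regular_tree h T" "\<And>x. x \<in> set_tree G \<Longrightarrow> p x < 2 ^ h \<and> \<phi> x = leaves T ! p x"
  shows "OV G T \<phi> = 2 * (\<Sum>(u, w)\<in>parcs (tree_digraph G). levels_apart h (p u) (p w))"
proof -
  have "tree_dist T (\<phi> u) (\<phi> w) = 2 * levels_apart h (p u) (p w)"
    if "(u, w) \<in> parcs (tree_digraph G)" for u w
    using that parcs_subset[of G] assms tree_dist_leaves[OF assms(1)] by (metis (no_types, lifting) SigmaE2 in_mono)
  then show ?thesis
    unfolding OV_def sum_distrib_left by (intro sum.cong) auto
qed

section \<open>The lower bound for every arrangement\<close>

text \<open>
  The marked vertices cut every path that descends through \<open>j + 1\<close> levels.  The library height of a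
  subtree is its number of levels.
\<close>
primrec marked :: "nat \<Rightarrow> 'a tree \<Rightarrow> 'a set" where
  "marked j \<langle>\<rangle> = {}"
| "marked j \<langle>l, v, r\<rangle> =
     (if Suc j dvd height \<langle>l, v, r\<rangle> then {v} else {}) \<union> marked j l \<union> marked j r"

definition inner_edges :: "'a set \<Rightarrow> 'a tree \<Rightarrow> nat" where
  "inner_edges B t = (\<Sum>(u, w)\<in>parcs (tree_digraph t). of_bool (u \<in> B \<and> w \<in> B))"

lemma marked_subset: "marked j t \<subseteq> set_tree t"
  by (induction t) auto

lemma inner_edges_Node:
  assumes "binary_regular_tree h l" "binary_regular_tree h r"
    "v \<notin> set_tree l" "v \<notin> set_tree r" "set_tree l \<inter> set_tree r = {}"
  shows "inner_edges B \<langle>l, v, r\<rangle> = of_bool (v \<in> B \<and> value l \<in> B) + of_bool (v \<in> B \<and> value r \<in> B) +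
    inner_edges B l + inner_edges B r"
  unfolding inner_edges_def sum_parcs_Node[OF assms] by simp

text \<open>
  The topmost \<open>Suc h mod Suc j\<close> levels are free of marks.  The other levels fall into complete trees
  with \<open>j + 1\<close> levels and \<open>2 ^ (j + 1) - 1\<close> vertices, and the marked vertices are the roots of
  these.
\<close>
lemma card_marked:
  assumes "binary_regular_tree h t"
  shows "card (marked j t) * (2 ^ Suc j - 1) + 2 ^ (Suc h mod Suc j) = 2 ^ Suc h"
  using assms
proof (induction rule: binary_regular_tree_induct)
  case (single v)
  then show ?case by (cases j) auto
next
  case (node h l v r)
  define q where "q = (2 ^ Suc j - 1 :: nat)"
  have fin: "finite (marked j l)" "finite (marked j r)"
    by (rule finite_subset[OF marked_subset]; simp)+
  have v: "v \<notin> marked j l \<union> marked j r" "marked j l \<inter> marked j r = {}"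
    using node.hyps marked_subset[of j l] marked_subset[of j r] by auto
  have card: "card (marked j \<langle>l, v, r\<rangle>) =
      of_bool (Suc j dvd Suc (Suc h)) + card (marked j l) + card (marked j r)"
    using v fin binary_regular_tree_not_empty(3)[OF node.hyps(1)]
      binary_regular_tree_not_empty(3)[OF node.hyps(2)] by (auto simp: card_Un_disjoint)
  have q: "q + 1 = 2 * 2 ^ j" by (simp add: q_def)
  have IH: "card (marked j l) * q + 2 ^ (Suc h mod Suc j) = 2 ^ Suc h"
    "card (marked j r) * q + 2 ^ (Suc h mod Suc j) = 2 ^ Suc h"
    using node.IH by (simp_all only: q_def)
  show ?case
  proof (cases "Suc j dvd Suc (Suc h)")
    case True
    then have "Suc (Suc h) mod Suc j = 0" by (rule dvd_imp_mod_0)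
    moreover from this have "Suc h mod Suc j = j" by (auto simp: mod_Suc split: if_splits)
    ultimately show ?thesis
      using IH q True unfolding card q_def[symmetric] by (simp add: distrib_right)
  next
    case False
    then have "Suc (Suc h) mod Suc j = Suc (Suc h mod Suc j)"
      by (metis dvd_eq_mod_eq_0 mod_Suc)
    then show ?thesis
      using IH False unfolding card q_def[symmetric] by (simp add: distrib_right)
  qed
qed

text \<open>
  For \<open>j \<ge> 1\<close> the power \<open>2 ^ (Suc h mod Suc j)\<close> in the previous lemma is smaller than the factor
  \<open>2 ^ Suc j - 1\<close>, that is, it is the remainder of the division.
\<close>
lemma card_marked_eq_div:
  assumes "binary_regular_tree h t" "j \<ge> 1"
  shows "card (marked j t) = 2 ^ Suc h div (2 ^ Suc j - 1)"
proof -
  have "(2::nat) ^ (Suc h mod Suc j) \<le> 2 ^ j"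
    by (rule power_increasing) (simp_all add: less_Suc_eq_le[symmetric])
  moreover have "(2::nat) ^ 1 \<le> 2 ^ j" using assms(2) by (intro power_increasing) auto
  ultimately have "(2::nat) ^ (Suc h mod Suc j) < 2 ^ Suc j - 1"
    unfolding power_Suc power_one_right by linarith
  then show ?thesis
    using card_marked[OF assms(1), of j]
    by (metis add.commute div_less div_mult_self3 gr_implies_not0 add_0_right)
qed

text \<open>
  The number of vertices of \<open>B\<close> minus the number of edges inside \<open>B\<close> is the number of components that
  \<open>B\<close> spans.  A nonempty set has at least one.  A set with at most one component and no marked vertex
  lies between two consecutive marked levels, hence in a complete tree with at most \<open>j\<close> levels.  The
  induction also needs the sharper bound for components containing the root, which end above the first marked
  level.
\<close>
lemma inner_edges_bound:
  assumes "binary_regular_tree h t"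
  shows "inner_edges B t + of_bool (B \<inter> set_tree t \<noteq> {}) \<le> card (B \<inter> set_tree t)"
    and "B \<inter> marked j t = {} \<Longrightarrow> card (B \<inter> set_tree t) \<le> inner_edges B t + 1 \<Longrightarrow>
      card (B \<inter> set_tree t) < 2 ^ j \<and> (value t \<in> B \<longrightarrow> card (B \<inter> set_tree t) < 2 ^ (Suc h mod Suc j))"
proof -
  have "inner_edges B t + of_bool (B \<inter> set_tree t \<noteq> {}) \<le> card (B \<inter> set_tree t) \<and>
    (B \<inter> marked j t = {} \<longrightarrow> card (B \<inter> set_tree t) \<le> inner_edges B t + 1 \<longrightarrow>
      card (B \<inter> set_tree t) < 2 ^ j \<and> (value t \<in> B \<longrightarrow> card (B \<inter> set_tree t) < 2 ^ (Suc h mod Suc j)))"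
    using assms
  proof (induction rule: binary_regular_tree_induct)
    case (single v)
    have "(1::nat) < 2 ^ j" if "\<not> Suc j dvd Suc 0" using that by (intro one_less_power) auto
    moreover have "Suc 0 mod Suc j = Suc 0" if "\<not> Suc j dvd Suc 0" using that by (cases j) auto
    ultimately show ?case by (auto simp: inner_edges_def parcs_single)
  next
    case (node h l v r)
    let ?l = "card (B \<inter> set_tree l)" and ?r = "card (B \<inter> set_tree r)"
    have "B \<inter> set_tree \<langle>l, v, r\<rangle> = (B \<inter> {v}) \<union> (B \<inter> set_tree l) \<union> (B \<inter> set_tree r)" by auto
    moreover have "card (B \<inter> {v} \<union> B \<inter> set_tree l \<union> B \<inter> set_tree r) = card (B \<inter> {v}) + ?l + ?r"
      using node.hyps by (subst card_Un_disjoint; auto)+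
    ultimately have card: "card (B \<inter> set_tree \<langle>l, v, r\<rangle>) = of_bool (v \<in> B) + ?l + ?r"
      by simp
    note inner = inner_edges_Node[OF node.hyps(1-5), of B]
    have ne: "value l \<in> B \<Longrightarrow> B \<inter> set_tree l \<noteq> {}" "value r \<in> B \<Longrightarrow> B \<inter> set_tree r \<noteq> {}"
      using binary_regular_tree_not_empty(2) node.hyps(1,2) by blast+
    have empty: "B \<inter> set_tree l = {} \<Longrightarrow> ?l = 0" "B \<inter> set_tree r = {} \<Longrightarrow> ?r = 0" by simp_all
    have IH1: "inner_edges B l + of_bool (B \<inter> set_tree l \<noteq> {}) \<le> ?l"
      "inner_edges B r + of_bool (B \<inter> set_tree r \<noteq> {}) \<le> ?r" using node.IH by auto
    have IH2: "?l < 2 ^ j \<and> (value l \<in> B \<longrightarrow> ?l < 2 ^ (Suc h mod Suc j))"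
      if "B \<inter> marked j l = {}" "?l \<le> inner_edges B l + 1" using node.IH that by blast
    have IH3: "?r < 2 ^ j \<and> (value r \<in> B \<longrightarrow> ?r < 2 ^ (Suc h mod Suc j))"
      if "B \<inter> marked j r = {}" "?r \<le> inner_edges B r + 1" using node.IH that by blast
    have le: "inner_edges B \<langle>l, v, r\<rangle> + of_bool (B \<inter> set_tree \<langle>l, v, r\<rangle> \<noteq> {}) \<le> card (B \<inter> set_tree \<langle>l, v, r\<rangle>)"
      using IH1 ne unfolding card inner by (auto simp: of_bool_def split: if_splits)
    have lt: "card (B \<inter> set_tree \<langle>l, v, r\<rangle>) < 2 ^ j \<and>
        (v \<in> B \<longrightarrow> card (B \<inter> set_tree \<langle>l, v, r\<rangle>) < 2 ^ (Suc (Suc h) mod Suc j))"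
      if un: "B \<inter> marked j \<langle>l, v, r\<rangle> = {}" and
        conn: "card (B \<inter> set_tree \<langle>l, v, r\<rangle>) \<le> inner_edges B \<langle>l, v, r\<rangle> + 1"
    proof -
      have un': "B \<inter> marked j l = {}" "B \<inter> marked j r = {}" using un by auto
      show ?thesis
      proof (cases "v \<in> B")
        case True
        have "\<not> Suc j dvd Suc (Suc h)"
          using un True binary_regular_tree_not_empty(3)[OF node.hyps(1)]
            binary_regular_tree_not_empty(3)[OF node.hyps(2)] by (auto split: if_splits)
        then have m: "Suc (Suc h) mod Suc j = Suc (Suc h mod Suc j)"
          by (metis dvd_eq_mod_eq_0 mod_Suc)
        \<comment> \<open>All of \<open>B\<close> is one component containing the root \<open>v\<close>, so \<open>B\<close> meets a subtree only in a component
            containing the root of that subtree.\<close>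
        have "?l \<le> inner_edges B l + of_bool (value l \<in> B)" "?r \<le> inner_edges B r + of_bool (value r \<in> B)"
          using conn True IH1 ne unfolding card inner by (auto simp: of_bool_def split: if_splits)
        then have "?l < 2 ^ (Suc h mod Suc j)" "?r < 2 ^ (Suc h mod Suc j)"
          using IH1 IH2[OF un'(1)] IH3[OF un'(2)] empty
          by (cases "value l \<in> B"; cases "B \<inter> set_tree l = {}"; simp;
              cases "value r \<in> B"; cases "B \<inter> set_tree r = {}"; simp)+
        then have *: "card (B \<inter> set_tree \<langle>l, v, r\<rangle>) < 2 ^ (Suc (Suc h) mod Suc j)"
          unfolding card m using True by simp
        also have "\<dots> \<le> 2 ^ j"
          by (rule power_increasing) (simp_all add: less_Suc_eq_le[symmetric])
        finally show ?thesis using * by blast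
      next
        case False
        \<comment> \<open>No edge joins the two parts of \<open>B\<close>, so one of them is empty.\<close>
        then have "?l + ?r \<le> inner_edges B l + inner_edges B r + 1"
          using conn unfolding card inner by simp
        then show ?thesis
          using IH1 IH2[OF un'(1)] IH3[OF un'(2)] empty False unfolding card
          by (cases "B \<inter> set_tree l = {}"; cases "B \<inter> set_tree r = {}"; simp)
      qed
    qed
    show ?case unfolding tree.sel using le lt by blast
  qed
  then show "inner_edges B t + of_bool (B \<inter> set_tree t \<noteq> {}) \<le> card (B \<inter> set_tree t)"
    and "B \<inter> marked j t = {} \<Longrightarrow> card (B \<inter> set_tree t) \<le> inner_edges B t + 1 \<Longrightarrow>
      card (B \<inter> set_tree t) < 2 ^ j \<and> (value t \<in> B \<longrightarrow> card (B \<inter> set_tree t) < 2 ^ (Suc h mod Suc j))"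
    by auto
qed

text \<open>
  A block with at most \<open>2 ^ j - 1\<close> vertices has at most \<open>2 ^ j - 2\<close> inner edges because it spans a
  forest; a full block without marked vertices because this forest is disconnected.  Stating both
  cases alike allows summing over all blocks although their sizes are unknown.
\<close>
lemma inner_edges_block:
  assumes "binary_regular_tree h t" "j \<ge> 1" "card (B \<inter> set_tree t) \<le> 2 ^ j"
  shows "inner_edges B t + 2 \<le> 2 ^ j + of_bool (B \<inter> marked j t \<noteq> {})"
proof (cases "B \<inter> set_tree t = {}")
  case True
  have "(2::nat) ^ 1 \<le> 2 ^ j" using assms(2) by (intro power_increasing) auto
  then show ?thesis using inner_edges_bound(1)[OF assms(1), of B] True by simp
next
  case False
  then have "inner_edges B t + 1 \<le> card (B \<inter> set_tree t)"
    using inner_edges_bound(1)[OF assms(1), of B] by simp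
  then show ?thesis
    using inner_edges_bound(2)[OF assms(1), of B j] assms(3)
    by (cases "B \<inter> marked j t = {}") auto
qed

lemma card_parcs:
  assumes "binary_regular_tree h t" shows "card (parcs (tree_digraph t)) + 2 = 2 ^ Suc h"
  using assms
proof (induction rule: binary_regular_tree_induct)
  case (node h l v r)
  then show ?case unfolding card_eq_sum sum_parcs_Node[OF node.hyps(1-5)] by simp
qed (simp add: parcs_single)

text \<open>
  Here \<open>\<beta>\<close> assigns to a vertex its block.  Every marked vertex makes up for at most one block with
  \<open>2 ^ j - 1\<close> inner edges.
\<close>
lemma cut_edges_bound:
  fixes \<beta> :: "'a \<Rightarrow> nat"
  assumes t: "binary_regular_tree h t" and j: "1 \<le> j" "j \<le> h"
    and blocks: "\<And>x. x \<in> set_tree t \<Longrightarrow> \<beta> x < 2 ^ (Suc h - j)"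
    and size: "\<And>b. card {x \<in> set_tree t. \<beta> x = b} \<le> 2 ^ j"
  shows "2 * 2 ^ (Suc h - j) \<le>
    (\<Sum>(u, w)\<in>parcs (tree_digraph t). of_bool (\<beta> u \<noteq> \<beta> w)) + 2 + card (marked j t)"
proof -
  let ?E = "parcs (tree_digraph t)" and ?k = "2 ^ (Suc h - j) :: nat"
  let ?B = "\<lambda>b. {x \<in> set_tree t. \<beta> x = b}"
  have edge: "(\<Sum>b<?k. of_bool (u \<in> ?B b \<and> w \<in> ?B b)) = (of_bool (\<beta> u = \<beta> w) :: nat)"
    if "(u, w) \<in> ?E" for u w
  proof -
    have uw: "u \<in> set_tree t" "w \<in> set_tree t" using that parcs_subset by fastforce+
    then have "(\<Sum>b<?k. of_bool (u \<in> ?B b \<and> w \<in> ?B b)) =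
        (\<Sum>b<?k. if b = \<beta> u then of_bool (\<beta> u = \<beta> w) else (0::nat))"
      by (intro sum.cong) auto
    also have "\<dots> = of_bool (\<beta> u = \<beta> w)" using blocks[OF uw(1)] by (subst sum.delta) auto
    finally show ?thesis .
  qed
  have "(\<Sum>b<?k. inner_edges (?B b) t) = (\<Sum>(u, w)\<in>?E. \<Sum>b<?k. of_bool (u \<in> ?B b \<and> w \<in> ?B b))"
    unfolding inner_edges_def by (subst sum.swap) (simp add: case_prod_unfold)
  also have "\<dots> = (\<Sum>(u, w)\<in>?E. of_bool (\<beta> u = \<beta> w))"
    using edge by (intro sum.cong) auto
  finally have inner: "(\<Sum>b<?k. inner_edges (?B b) t) = (\<Sum>(u, w)\<in>?E. of_bool (\<beta> u = \<beta> w))" .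
  have "(\<Sum>b<?k. inner_edges (?B b) t + 2) \<le> (\<Sum>b<?k. 2 ^ j + of_bool (?B b \<inter> marked j t \<noteq> {}))"
    using size by (intro sum_mono inner_edges_block[OF t j(1)]) (simp add: Int_absorb2 Int_def conj_ac)
  moreover have "(\<Sum>b<?k. of_bool (?B b \<inter> marked j t \<noteq> {}) :: nat) \<le> card (marked j t)"
  proof -
    have fin: "finite (marked j t)" by (rule finite_subset[OF marked_subset]) simp
    have "(\<Sum>b<?k. of_bool (?B b \<inter> marked j t \<noteq> {}) :: nat) = card {b \<in> {..<?k}. ?B b \<inter> marked j t \<noteq> {}}"
      by (simp add: of_bool_def sum.If_cases Int_def)
    also have "\<dots> \<le> card (\<beta> ` marked j t)"
      using fin by (intro card_mono) auto
    also have "\<dots> \<le> card (marked j t)" using fin by (rule card_image_le)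
    finally show ?thesis .
  qed
  ultimately have "(\<Sum>(u, w)\<in>?E. of_bool (\<beta> u = \<beta> w)) + 2 * ?k \<le> ?k * 2 ^ j + card (marked j t)"
    unfolding sum.distrib inner by simp
  moreover have "?k * 2 ^ j = (2::nat) ^ Suc h" using j by (simp flip: power_add)
  moreover have "(\<Sum>(u, w)\<in>?E. of_bool (\<beta> u \<noteq> \<beta> w)) + (\<Sum>(u, w)\<in>?E. of_bool (\<beta> u = \<beta> w)) = card ?E"
    unfolding sum.distrib[symmetric] card_eq_sum by (intro sum.cong) auto
  moreover note card_parcs[OF t]
  ultimately show ?thesis by linarith
qed

lemma parcs_irrefl:
  assumes "binary_regular_tree h t" "(u, w) \<in> parcs (tree_digraph t)"
  shows "u \<noteq> w"
  using assms
proof (induction rule: binary_regular_tree_induct)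
  case (node h l v r)
  then show ?case
    using binary_regular_tree_not_empty(2)[OF node.hyps(1)] binary_regular_tree_not_empty(2)[OF node.hyps(2)]
    unfolding parcs_Node[OF node.hyps(1,2)] by auto
qed (simp add: parcs_single)

text \<open>
  The constant 6 collects the terms of lower order: the sum over \<open>j \<in> {1..h}\<close> of the numbers
  \<open>2 * 2 ^ (h + 1 - j)\<close> is \<open>4 * 2 ^ h - 4\<close>, and level 0 contributes all \<open>2 * 2 ^ h - 2\<close> edges.
\<close>
lemma OV_lower_bound:
  fixes h :: nat
  defines "D \<equiv> \<Sum>j\<in>{1..h}. 2 ^ Suc h div (2 ^ Suc j - 1)"
  assumes G: "binary_regular_tree h G" and T: "binary_regular_tree (Suc h) T"
    and arr: "arrangement G T \<phi>"
  shows "2 * (6 * 2 ^ h) \<le> OV G T \<phi> + 2 * (6 + 2 * h + D)"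
proof -
  let ?E = "parcs (tree_digraph G)"
  have "\<exists>i. i < 2 ^ Suc h \<and> \<phi> x = leaves T ! i" if "x \<in> set_tree G" for x
    using that arr leaves_regular(1)[OF T] unfolding arrangement_def
    by (metis image_subset_iff in_set_conv_nth)
  then obtain p where p: "\<And>x. x \<in> set_tree G \<Longrightarrow> p x < 2 ^ Suc h \<and> \<phi> x = leaves T ! p x"
    by metis
  have inj: "inj_on p (set_tree G)"
    using arr p unfolding arrangement_def inj_on_def by metis
  define cut where "cut j = (\<Sum>(u, w)\<in>?E. of_bool (p u div 2 ^ j \<noteq> p w div 2 ^ j) :: nat)" for j
  have "OV G T \<phi> = 2 * (\<Sum>(u, w)\<in>?E. \<Sum>j<Suc h. of_bool (p u div 2 ^ j \<noteq> p w div 2 ^ j))"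
    using OV_positions[OF T p] unfolding levels_apart_def by simp
  also have "\<dots> = 2 * (\<Sum>j<Suc h. cut j)"
    unfolding cut_def by (subst sum.swap) (simp add: case_prod_unfold)
  also have "(\<Sum>j<Suc h. cut j) = cut 0 + (\<Sum>j\<in>{1..h}. cut j)"
    by (simp add: sum.lessThan_Suc_shift sum.atLeast1_atMost_eq del: sum.lessThan_Suc)
  finally have OV: "OV G T \<phi> = 2 * (cut 0 + (\<Sum>j\<in>{1..h}. cut j))" .
  have "cut 0 = card ?E"
    unfolding cut_def card_eq_sum
  proof (intro sum.cong refl, clarify)
    fix u w assume uw: "(u, w) \<in> ?E"
    have "u \<in> set_tree G" "w \<in> set_tree G" "u \<noteq> w"
      using uw parcs_subset[of G] parcs_irrefl[OF G uw] by auto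
    then have "p u \<noteq> p w" using inj by (meson inj_on_eq_iff)
    then show "of_bool (p u div 2 ^ 0 \<noteq> p w div 2 ^ 0) = (1::nat)" by simp
  qed
  then have cut0: "cut 0 + 2 = 2 * 2 ^ h" using card_parcs[OF G] by simp
  have "2 * 2 ^ (Suc h - j) \<le> cut j + 2 + 2 ^ Suc h div (2 ^ Suc j - 1)" if j: "j \<in> {1..h}" for j
  proof -
    have j': "1 \<le> j" "j \<le> h" using j by auto
    have "p x div 2 ^ j < 2 ^ (Suc h - j)" if "x \<in> set_tree G" for x
    proof -
      have "(2::nat) ^ Suc h = 2 ^ (Suc h - j) * 2 ^ j" using j' by (simp flip: power_add)
      then show ?thesis using p[OF that] by (simp add: less_mult_imp_div_less)
    qed
    moreover have "card {x \<in> set_tree G. p x div 2 ^ j = b} \<le> 2 ^ j" for b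
    proof -
      have "card {x \<in> set_tree G. p x div 2 ^ j = b} = card (p ` {x \<in> set_tree G. p x div 2 ^ j = b})"
        using inj by (intro card_image[symmetric] inj_on_subset[OF inj]) auto
      also have "\<dots> \<le> card {b * 2 ^ j..<b * 2 ^ j + 2 ^ j}"
      proof (intro card_mono subsetI, simp)
        fix y assume "y \<in> p ` {x \<in> set_tree G. p x div 2 ^ j = b}"
        then have "y div 2 ^ j = b" by auto
        then show "y \<in> {b * 2 ^ j..<b * 2 ^ j + 2 ^ j}"
          using dividend_less_div_times[of "2 ^ j" y] div_times_less_eq_dividend[of y "2 ^ j"]
          by (auto simp: add.commute)
      qed
      finally show ?thesis by simp
    qed
    ultimately have "2 * 2 ^ (Suc h - j) \<le> cut j + 2 + card (marked j G)"
      unfolding cut_def by (intro cut_edges_bound[OF G j']) auto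
    then show ?thesis unfolding card_marked_eq_div[OF G j'(1)] .
  qed
  then have "(\<Sum>j\<in>{1..h}. 2 * 2 ^ (Suc h - j)) \<le>
      (\<Sum>j\<in>{1..h}. cut j + 2 + 2 ^ Suc h div (2 ^ Suc j - 1))" by (rule sum_mono)
  also have "\<dots> = (\<Sum>j\<in>{1..h}. cut j) + 2 * h + D"
    unfolding sum.distrib D_def by simp
  finally have cuts: "(\<Sum>j\<in>{1..h}. 2 * 2 ^ (Suc h - j)) \<le> (\<Sum>j\<in>{1..h}. cut j) + 2 * h + D" .
  have "(\<Sum>k<h. 2 * 2 ^ (h - k)) + 4 = (4 * 2 ^ h :: nat)"
    by (induction h) (simp_all add: sum.lessThan_Suc_shift del: sum.lessThan_Suc)
  then have "(\<Sum>j\<in>{1..h}. 2 * 2 ^ (Suc h - j)) + 4 = (4 * 2 ^ h :: nat)"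
    by (simp add: sum.atLeast1_atMost_eq)
  then have "4 * 2 ^ h \<le> (\<Sum>j\<in>{1..h}. cut j) + 2 * h + D + 4"
    using cuts by (metis add_le_mono1)
  moreover have "2 * (6 * X) \<le> 2 * (c + S) + 2 * (6 + 2 * h + d)"
    if "c + 2 = 2 * X" "4 * X \<le> S + 2 * h + d + 4" for c X S d :: nat
    using that by simp
  ultimately show ?thesis using cut0 unfolding OV by blast
qed

section \<open>The cost of the algorithm\<close>

text \<open>
  Half the objective value of the computed arrangement.  The pair-exchange takes place at odd
  height \<open>Suc h \<ge> 3\<close> and saves 1.
\<close>
primrec alg_cost :: "nat \<Rightarrow> nat" where
  "alg_cost 0 = 0"
| "alg_cost (Suc h) = 2 * alg_cost h + 2 * h + (if even h \<and> h \<ge> 2 then 2 else 3)"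

lemma alg_cost_closed_form:
  assumes "h \<ge> 1"
  shows "6 * alg_cost h + 12 * h + (if odd h then 28 else 26) = 29 * 2 ^ h"
  using assms
proof (induction h rule: nat_induct_at_least)
  case (Suc h)
  then show ?case by (cases "even h"; cases "h = 1") auto
qed simp

text \<open>
  Positions computed by the algorithm are counted from 1, whereas \<^const>\<open>levels_apart\<close> counts
  leaves from 0.
\<close>
definition half_cost :: "nat \<Rightarrow> ('a \<Rightarrow> nat) \<Rightarrow> 'a tree \<Rightarrow> nat" where
  "half_cost h a t = (\<Sum>(u, w)\<in>parcs (tree_digraph t). levels_apart (Suc h) (a u - 1) (a w - 1))"

text \<open>
  For \<open>x\<close> in a binary regular tree this says that \<open>x\<close> is a leaf with parent \<open>u\<close>.  Only one arc is affected
  when such a vertex moves.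
\<close>
definition pendant :: "'a tree \<Rightarrow> 'a \<Rightarrow> 'a \<Rightarrow> bool" where
  "pendant t u x \<longleftrightarrow> (u, x) \<in> parcs (tree_digraph t) \<and>
     (\<forall>(y, z)\<in>parcs (tree_digraph t). y \<noteq> x \<and> (z = x \<longrightarrow> y = u))"

text \<open>
  The two positions before \<open>m\<close> hold a guest leaf and, in front of it, its parent.  With \<open>m\<close> a quarter
  of the number of host leaves this describes the vertex that takes part in the pair-exchange.
\<close>
definition pendant_before :: "'a tree \<Rightarrow> ('a \<Rightarrow> nat) \<Rightarrow> nat \<Rightarrow> bool" where
  "pendant_before t a m \<longleftrightarrow> (\<exists>u x. pendant t u x \<and> a x = m - 1 \<and> a u = m - 2)"

text \<open>
  The last position \<open>2 ^ Suc h\<close> stays free, which is where the left copy receives the root of the next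
  larger tree.  The bound on the position of the root places it in the left half.
\<close>
definition layout :: "nat \<Rightarrow> 'a tree \<Rightarrow> ('a \<Rightarrow> nat) \<Rightarrow> bool" where
  "layout h t a \<longleftrightarrow> inj_on a (set_tree t) \<and> a ` set_tree t \<subseteq> {1..<2 ^ Suc h} \<and>
     a (value t) \<le> 2 ^ h \<and> (h \<ge> 1 \<longrightarrow> pendant_before t a (2 ^ Suc h))"

lemma pendant_in_set_tree: "pendant t u x \<Longrightarrow> u \<in> set_tree t \<and> x \<in> set_tree t"
  using parcs_subset[of t] by (auto simp: pendant_def)

lemma pendant_Node:
  assumes "binary_regular_tree h l" "binary_regular_tree h r"
    "v \<notin> set_tree l" "v \<notin> set_tree r" "set_tree l \<inter> set_tree r = {}"
  shows "pendant l u x \<Longrightarrow> x \<noteq> value l \<Longrightarrow> pendant \<langle>l, v, r\<rangle> u x"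
    and "pendant r u x \<Longrightarrow> x \<noteq> value r \<Longrightarrow> pendant \<langle>l, v, r\<rangle> u x"
proof -
  note E = parcs_Node[OF assms(1,2), of v]
  have roots: "value l \<in> set_tree l" "value r \<in> set_tree r"
    using assms(1,2) binary_regular_tree_not_empty(2) by auto
  show "pendant \<langle>l, v, r\<rangle> u x" if "pendant l u x" "x \<noteq> value l"
    using that pendant_in_set_tree[OF that(1)] roots assms(3-5) parcs_subset[of r]
    unfolding pendant_def E by auto
  show "pendant \<langle>l, v, r\<rangle> u x" if "pendant r u x" "x \<noteq> value r"
    using that pendant_in_set_tree[OF that(1)] roots assms(3-5) parcs_subset[of l]
    unfolding pendant_def E by auto
qed

lemma no_parc_to_root:
  assumes "binary_regular_tree h t" "(u, w) \<in> parcs (tree_digraph t)"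
  shows "w \<noteq> value t"
  using assms
proof (cases h)
  case 0
  then show ?thesis using assms by (auto simp: binary_regular_tree_0_iff parcs_single)
next
  case (Suc h')
  then obtain l v r where t: "t = \<langle>l, v, r\<rangle>" "binary_regular_tree h' l" "binary_regular_tree h' r"
    "v \<notin> set_tree l" "v \<notin> set_tree r"
    using assms(1) unfolding Suc binary_regular_tree_Suc_iff by blast
  then show ?thesis
    using assms(2) binary_regular_tree_not_empty(2)[OF t(2)] binary_regular_tree_not_empty(2)[OF t(3)]
      parcs_subset[of l] parcs_subset[of r]
    unfolding t(1) parcs_Node[OF t(2,3)] by auto
qed

lemma pendant_before_Node:
  assumes "binary_regular_tree h l" "binary_regular_tree h r"
    "v \<notin> set_tree l" "v \<notin> set_tree r" "set_tree l \<inter> set_tree r = {}"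
  shows "pendant_before l a m \<Longrightarrow> (\<And>x. x \<in> set_tree l \<Longrightarrow> a' x = a x) \<Longrightarrow> pendant_before \<langle>l, v, r\<rangle> a' m"
    and "pendant_before r a m \<Longrightarrow> (\<And>x. x \<in> set_tree r \<Longrightarrow> a' x = n + a x) \<Longrightarrow> m \<ge> 2 \<Longrightarrow>
      pendant_before \<langle>l, v, r\<rangle> a' (n + m)"
proof -
  show "pendant_before \<langle>l, v, r\<rangle> a' m" if p: "pendant_before l a m" and eq: "\<And>x. x \<in> set_tree l \<Longrightarrow> a' x = a x"
  proof -
    obtain u x where ux: "pendant l u x" "a x = m - 1" "a u = m - 2"
      using p unfolding pendant_before_def by blast
    have "x \<noteq> value l" using ux(1) no_parc_to_root[OF assms(1)] unfolding pendant_def by blast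
    then show ?thesis
      using pendant_Node(1)[OF assms ux(1)] ux pendant_in_set_tree[OF ux(1)] eq
      unfolding pendant_before_def by metis
  qed
  show "pendant_before \<langle>l, v, r\<rangle> a' (n + m)"
    if p: "pendant_before r a m" and eq: "\<And>x. x \<in> set_tree r \<Longrightarrow> a' x = n + a x" and m: "m \<ge> 2"
  proof -
    obtain u x where ux: "pendant r u x" "a x = m - 1" "a u = m - 2"
      using p unfolding pendant_before_def by blast
    have "x \<noteq> value r" using ux(1) no_parc_to_root[OF assms(2)] unfolding pendant_def by blast
    moreover have "a' x = n + m - 1" "a' u = n + m - 2"
      using ux pendant_in_set_tree[OF ux(1)] eq m by auto
    ultimately show ?thesis
      using pendant_Node(2)[OF assms ux(1)] unfolding pendant_before_def by metis
  qed
qed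

text \<open>
  Step (ii) and step (iii) of the algorithm: \<open>m\<close> is the number of leaves of the left half.
\<close>
definition join :: "nat \<Rightarrow> 'a \<Rightarrow> 'a set \<Rightarrow> ('a \<Rightarrow> nat) \<Rightarrow> ('a \<Rightarrow> nat) \<Rightarrow> 'a \<Rightarrow> nat" where
  "join m v L f g x = (if x = v then m else if x \<in> L then f x else m + g x)"

lemma join_simps:
  assumes "v \<notin> set_tree l" "v \<notin> set_tree r" "set_tree l \<inter> set_tree r = {}"
  shows "join m v (set_tree l) f g v = m"
    "x \<in> set_tree l \<Longrightarrow> join m v (set_tree l) f g x = f x"
    "x \<in> set_tree r \<Longrightarrow> join m v (set_tree l) f g x = m + g x"
  using assms by (auto simp: join_def)

text \<open>
  The root \<open>v\<close> sits at the last position of the left half, and the root of the left subtree in the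
  left quarter, so that the edge between them is cut on all levels but the highest.  The edge to
  the right subtree is cut on every level.
\<close>
lemma layout_join:
  fixes l r :: "'a tree" and v :: 'a and a1 a2 :: "'a \<Rightarrow> nat" and h :: nat
  defines "a \<equiv> join (2 ^ Suc h) v (set_tree l) a1 a2"
  assumes lr: "binary_regular_tree h l" "binary_regular_tree h r"
    "v \<notin> set_tree l" "v \<notin> set_tree r" "set_tree l \<inter> set_tree r = {}"
    and lay: "layout h l a1" "layout h r a2"
  shows "layout (Suc h) \<langle>l, v, r\<rangle> a"
    and "half_cost (Suc h) a \<langle>l, v, r\<rangle> = half_cost h a1 l + half_cost h a2 r + 2 * h + 3"
proof -
  let ?m = "2 ^ Suc h :: nat"
  note j = join_simps[OF lr(3-5), where m = ?m and f = a1 and g = a2, folded a_def]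
  have roots: "value l \<in> set_tree l" "value r \<in> set_tree r"
    using lr(1,2) binary_regular_tree_not_empty(2) by auto
  have r1: "1 \<le> a1 x" "a1 x < ?m" if "x \<in> set_tree l" for x
    using lay(1) that by (force simp: layout_def)+
  have r2: "1 \<le> a2 x" "a2 x < ?m" if "x \<in> set_tree r" for x
    using lay(2) that by (force simp: layout_def)+
  have inj1: "inj_on a1 (set_tree l)" "inj_on a2 (set_tree r)" "a1 (value l) \<le> 2 ^ h"
    using lay by (auto simp: layout_def)
  have "inj_on a (set_tree \<langle>l, v, r\<rangle>)"
  proof (rule inj_onI)
    fix x y assume xy: "x \<in> set_tree \<langle>l, v, r\<rangle>" "y \<in> set_tree \<langle>l, v, r\<rangle>" "a x = a y"
    have val: "z = v \<and> a z = ?m \<or> z \<in> set_tree l \<and> a z < ?m \<and> a z = a1 z \<or>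
        z \<in> set_tree r \<and> a z > ?m \<and> a z = ?m + a2 z" if "z \<in> set_tree \<langle>l, v, r\<rangle>" for z
      using that j r1[of z] r2[of z] by auto
    show "x = y"
      using val[OF xy(1)] val[OF xy(2)] xy(3) inj1(1,2) by (auto dest: inj_onD)
  qed
  moreover have "a x \<in> {1..<2 ^ Suc (Suc h)}" if "x \<in> set_tree \<langle>l, v, r\<rangle>" for x
    using that j r1[of x] r2[of x] by auto
  moreover have "pendant_before \<langle>l, v, r\<rangle> a (2 ^ Suc (Suc h))"
  proof (cases "h = 0")
    case True
    then obtain x y where xy: "l = \<langle>\<langle>\<rangle>, x, \<langle>\<rangle>\<rangle>" "r = \<langle>\<langle>\<rangle>, y, \<langle>\<rangle>\<rangle>"
      using lr(1,2) by (auto simp: binary_regular_tree_0_iff)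
    have "pendant \<langle>l, v, r\<rangle> v y"
      using lr xy unfolding pendant_def parcs_Node[OF lr(1,2)] by (auto simp: parcs_single)
    moreover have "a y = 3" "a v = 2" using j r2[of y] xy True by auto
    ultimately show ?thesis using True unfolding pendant_before_def by fastforce
  next
    case False
    then have "pendant_before r a2 ?m" using lay(2) by (simp add: layout_def)
    moreover have "?m \<ge> 2" by simp
    ultimately have "pendant_before \<langle>l, v, r\<rangle> a (?m + ?m)"
      using pendant_before_Node(2)[OF lr] j(3) by blast
    then show ?thesis by (simp add: mult_2)
  qed
  ultimately show "layout (Suc h) \<langle>l, v, r\<rangle> a"
    unfolding layout_def using j(1) by auto
  have E1: "levels_apart (Suc (Suc h)) (a u - 1) (a w - 1) = levels_apart (Suc h) (a1 u - 1) (a1 w - 1)"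
    if "(u, w) \<in> parcs (tree_digraph l)" for u w
  proof -
    have "u \<in> set_tree l" "w \<in> set_tree l" using that parcs_subset[of l] by auto
    then show ?thesis using r1[of u] r1[of w] by (simp add: j levels_apart_same_half(1))
  qed
  have E2: "levels_apart (Suc (Suc h)) (a u - 1) (a w - 1) = levels_apart (Suc h) (a2 u - 1) (a2 w - 1)"
    if "(u, w) \<in> parcs (tree_digraph r)" for u w
  proof -
    have uw: "u \<in> set_tree r" "w \<in> set_tree r" using that parcs_subset[of r] by auto
    have "a u - 1 = ?m + (a2 u - 1)" "a w - 1 = ?m + (a2 w - 1)"
      using uw r2[of u] r2[of w] by (simp_all add: j)
    then show ?thesis using r2[OF uw(1)] r2[OF uw(2)] by (simp only: levels_apart_same_half(2))
  qed
  have "levels_apart (Suc (Suc h)) (a v - 1) (a (value l) - 1) = levels_apart (Suc h) (?m - 1) (a1 (value l) - 1)"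
    using r1[OF roots(1)] roots by (simp add: j levels_apart_same_half(1))
  also have "\<dots> = levels_apart (Suc h) (a1 (value l) - 1) (?m - 1)" by (rule levels_apart_commute)
  also have "\<dots> = Suc h"
    using inj1(3) r1[OF roots(1)] by (intro levels_apart_halves) auto
  finally have vl: "levels_apart (Suc (Suc h)) (a v - 1) (a (value l) - 1) = Suc h" .
  have vr: "levels_apart (Suc (Suc h)) (a v - 1) (a (value r) - 1) = Suc (Suc h)"
    using r2[OF roots(2)] roots by (intro levels_apart_halves) (auto simp: j)
  have "(\<Sum>(u, w)\<in>parcs (tree_digraph l). levels_apart (Suc (Suc h)) (a u - 1) (a w - 1)) = half_cost h a1 l"
    "(\<Sum>(u, w)\<in>parcs (tree_digraph r). levels_apart (Suc (Suc h)) (a u - 1) (a w - 1)) = half_cost h a2 r"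
    unfolding half_cost_def using E1 E2 by (intro sum.cong; auto)+
  then show "half_cost (Suc h) a \<langle>l, v, r\<rangle> = half_cost h a1 l + half_cost h a2 r + 2 * h + 3"
    unfolding half_cost_def[of "Suc h"] sum_parcs_Node[OF lr] using vl vr by simp
qed

lemma levels_apart_Suc:
  "levels_apart (Suc n) i k = of_bool (i \<noteq> k) + levels_apart n (i div 2) (k div 2)"
  unfolding levels_apart_def sum.lessThan_Suc_shift by (simp add: div_mult2_eq)

lemma levels_apart_refl: "levels_apart n i i = 0"
  by (simp add: levels_apart_def)

text \<open>
  After the exchange the root \<open>v\<close> is next to its left child, which saves \<open>h\<close> levels on that
  edge.  The guest leaf \<open>x\<close> moves from the left quarter, where it shares a block of 4 with its parent
  \<open>u\<close>, to the end of the left half, which costs \<open>h - 1\<close> levels.  The edge to the right child is cut on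
  every level before and after, and no other edge changes its length.
\<close>
lemma layout_exchange:
  fixes l r :: "'a tree" and v :: 'a and a1 a2 :: "'a \<Rightarrow> nat" and h :: nat
  defines "a \<equiv> join (2 ^ Suc h) v (set_tree l) a1 a2"
    and "s \<equiv> transpose (2 ^ h - 1) (2 ^ Suc h)"
  assumes lr: "binary_regular_tree h l" "binary_regular_tree h r"
    "v \<notin> set_tree l" "v \<notin> set_tree r" "set_tree l \<inter> set_tree r = {}"
    and lay: "layout h l a1" "layout h r a2"
    and h: "h \<ge> 2" and root: "a1 (value l) = 2 ^ h" and pend: "pendant_before l a1 (2 ^ h)"
  shows "layout (Suc h) \<langle>l, v, r\<rangle> (s \<circ> a)"
    and "half_cost (Suc h) (s \<circ> a) \<langle>l, v, r\<rangle> + 1 = half_cost (Suc h) a \<langle>l, v, r\<rangle>"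
proof -
  let ?m = "2 ^ Suc h :: nat"
  note j = join_simps[OF lr(3-5), where m = ?m and f = a1 and g = a2, folded a_def]
  have lay': "layout (Suc h) \<langle>l, v, r\<rangle> a" unfolding a_def by (rule layout_join(1)[OF lr lay])
  have roots: "value l \<in> set_tree l" "value r \<in> set_tree r"
    using lr(1,2) binary_regular_tree_not_empty(2) by auto
  have r1: "1 \<le> a1 x" "a1 x < ?m" if "x \<in> set_tree l" for x
    using lay(1) that by (force simp: layout_def)+
  have r2: "1 \<le> a2 x" "a2 x < ?m" if "x \<in> set_tree r" for x
    using lay(2) that by (force simp: layout_def)+
  \<comment> \<open>The positions next to \<open>2 ^ h\<close> are compared through their blocks of 2 and 4 leaves.\<close>
  obtain k where "h = 2 + k" using h le_Suc_ex by blast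
  then obtain q :: nat where q: "2 ^ h = 4 * q" "q \<ge> 1" by (intro that[of "2 ^ k"]) auto
  obtain u x where ux: "pendant l u x" "a1 x = 2 ^ h - 1" "a1 u = 2 ^ h - 2"
    using pend unfolding pendant_before_def by blast
  have ux_l: "u \<in> set_tree l" "x \<in> set_tree l" using pendant_in_set_tree[OF ux(1)] by auto
  have s: "s (2 ^ h - 1) = ?m" "s ?m = 2 ^ h - 1" "\<And>n. n \<noteq> 2 ^ h - 1 \<Longrightarrow> n \<noteq> ?m \<Longrightarrow> s n = n"
    by (auto simp: s_def transpose_def)
  have s_l: "s (a y) = a y" if "y \<in> set_tree l" "y \<noteq> x" for y
  proof -
    have "a1 y \<noteq> a1 x" using that ux_l lay(1) unfolding layout_def by (metis inj_on_eq_iff)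
    then show ?thesis using r1[OF that(1)] ux(2) by (intro s(3)) (auto simp: j that)
  qed
  have s_r: "s (a y) = a y" if "y \<in> set_tree r" for y
    using r2[OF that] q by (intro s(3)) (auto simp: j that)
  have s_v: "s (a v) = 2 ^ h - 1" and s_x: "s (a x) = ?m"
    using s ux ux_l by (simp_all add: j)
  obtain y z where yz: "pendant \<langle>l, v, r\<rangle> y z" "a z = 2 ^ Suc (Suc h) - 1" "a y = 2 ^ Suc (Suc h) - 2"
    using lay' by (auto simp: layout_def pendant_before_def)
  have "s (a z) = a z" "s (a y) = a y" using q unfolding yz(2,3) by (intro s(3); simp)+
  then have "pendant_before \<langle>l, v, r\<rangle> (s \<circ> a) (2 ^ Suc (Suc h))"
    using yz unfolding pendant_before_def by (metis comp_apply)
  moreover have "inj_on (s \<circ> a) (set_tree \<langle>l, v, r\<rangle>)"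
    using lay' by (intro comp_inj_on) (simp_all only: layout_def s_def inj_on_transpose)
  moreover have "(s \<circ> a) ` set_tree \<langle>l, v, r\<rangle> \<subseteq> {1..<2 ^ Suc (Suc h)}"
  proof -
    have "s n \<in> {1..<2 ^ Suc (Suc h)}" if "n \<in> {1..<2 ^ Suc (Suc h)}" for n
    proof -
      have "s n = n \<or> s n = ?m \<or> s n = 2 ^ h - 1" using s by metis
      moreover have "?m \<in> {1..<2 ^ Suc (Suc h)}" "(2::nat) ^ h - 1 \<in> {1..<2 ^ Suc (Suc h)}" using q by auto
      ultimately show ?thesis using that by metis
    qed
    moreover have "a ` set_tree \<langle>l, v, r\<rangle> \<subseteq> {1..<2 ^ Suc (Suc h)}"
      using lay' by (simp only: layout_def)
    ultimately show ?thesis unfolding image_comp[symmetric] by blast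
  qed
  moreover have "(s \<circ> a) (value \<langle>l, v, r\<rangle>) \<le> 2 ^ Suc h" using s_v by simp
  ultimately show "layout (Suc h) \<langle>l, v, r\<rangle> (s \<circ> a)" unfolding layout_def by blast

  let ?d = "levels_apart (Suc (Suc h))"
  let ?f = "\<lambda>(y, z). ?d (a y - 1) (a z - 1)" and ?f' = "\<lambda>(y, z). ?d ((s \<circ> a) y - 1) ((s \<circ> a) z - 1)"
  have other: "?f' e = ?f e" if e_in: "e \<in> parcs (tree_digraph l) - {(u, x)}" for e
  proof -
    obtain y z where e: "e = (y, z)" "y \<in> set_tree l" "z \<in> set_tree l" "(y, z) \<in> parcs (tree_digraph l)"
      using e_in parcs_subset[of l] by (cases e) auto
    then have "y \<noteq> x" "z \<noteq> x" using e_in ux(1) unfolding pendant_def by auto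
    then show ?thesis using e s_l by simp
  qed
  have right: "?f' e = ?f e" if "e \<in> parcs (tree_digraph r)" for e
    using that parcs_subset[of r] s_r by (cases e) auto
  have ux_E: "(u, x) \<in> parcs (tree_digraph l)" "u \<noteq> x" using ux(1) unfolding pendant_def by auto
  have ux_old: "?f (u, x) = 2"
  proof -
    have "(4 * q - 3) div 2 = 2 * q - 2" "(4 * q - 2) div 2 = 2 * q - 1"
      "(2 * q - 2) div 2 = q - 1" "(2 * q - 1) div 2 = q - 1"
      "4 * q - 3 \<noteq> 4 * q - 2" "2 * q - 2 \<noteq> 2 * q - 1" using q(2) by arith+
    moreover have "a u - 1 = 4 * q - 3" "a x - 1 = 4 * q - 2" using ux ux_l q by (simp_all add: j)
    ultimately show ?thesis using q(2) by (simp add: levels_apart_Suc levels_apart_refl)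
  qed
  have half: "?d i k = Suc h" if "i < 2 ^ h" "2 ^ h \<le> k" "k < ?m" for i k
    using that by (simp add: levels_apart_same_half(1) levels_apart_halves)
  have ux_new: "?f' (u, x) = Suc h"
    using s_x s_l[OF ux_l(1) ux_E(2)] ux ux_l q by (simp add: j half)
  have vl_old: "?f (v, value l) = Suc h"
  proof -
    have "?d (2 ^ h - 1) (?m - 1) = Suc h" using q by (intro half) auto
    then have "?d (?m - 1) (2 ^ h - 1) = Suc h" by (simp only: levels_apart_commute)
    then show ?thesis using roots root by (simp add: j)
  qed
  have "value l \<noteq> x" using root ux(2) q by auto
  have vl_new: "?f' (v, value l) = 1"
  proof -
    have "(4 * q - 2) div 2 = 2 * q - 1" "(4 * q - 1) div 2 = 2 * q - 1"
      "4 * q - 2 \<noteq> 4 * q - 1" using q(2) by arith+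
    moreover have "(s \<circ> a) v - 1 = 4 * q - 2" "(s \<circ> a) (value l) - 1 = 4 * q - 1"
      using s_v s_l[OF roots(1) \<open>value l \<noteq> x\<close>] roots root q by (simp_all add: j)
    ultimately show ?thesis using q(2) by (simp add: levels_apart_Suc[of "Suc h"] levels_apart_refl)
  qed
  have vr: "?f' (v, value r) = ?f (v, value r)"
  proof -
    have "?f (v, value r) = Suc (Suc h)"
      using roots r2[OF roots(2)] by (simp add: j levels_apart_halves)
    moreover have "?f' (v, value r) = Suc (Suc h)"
      using s_v s_r[OF roots(2)] roots r2[OF roots(2)] q by (simp add: j levels_apart_halves)
    ultimately show ?thesis by simp
  qed
  have "(\<Sum>e\<in>parcs (tree_digraph l). ?f e) = 2 + (\<Sum>e\<in>parcs (tree_digraph l) - {(u, x)}. ?f e)"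
    "(\<Sum>e\<in>parcs (tree_digraph l). ?f' e) = Suc h + (\<Sum>e\<in>parcs (tree_digraph l) - {(u, x)}. ?f' e)"
    unfolding sum.remove[OF finite_parcs ux_E(1)] ux_old ux_new by simp_all
  moreover have "(\<Sum>e\<in>parcs (tree_digraph l) - {(u, x)}. ?f' e) = (\<Sum>e\<in>parcs (tree_digraph l) - {(u, x)}. ?f e)"
    using other by (intro sum.cong) auto
  moreover have "(\<Sum>e\<in>parcs (tree_digraph r). ?f' e) = (\<Sum>e\<in>parcs (tree_digraph r). ?f e)"
    using right by (intro sum.cong) auto
  ultimately show "half_cost (Suc h) (s \<circ> a) \<langle>l, v, r\<rangle> + 1 = half_cost (Suc h) a \<langle>l, v, r\<rangle>"
    unfolding half_cost_def sum_parcs_Node[OF lr] vl_old vl_new vr by linarith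
qed

lemma algA_index_Node:
  assumes "binary_regular_tree h l"
  shows "algA_index \<langle>l, v, r\<rangle> =
    (if even h \<and> h \<ge> 2 then transpose (2 ^ h - 1) (2 ^ Suc h) else id) \<circ>
      join (2 ^ Suc h) v (set_tree l) (algA_index l) (algA_index r)"
proof -
  have "height l = Suc h" by (rule binary_regular_tree_not_empty(3)[OF assms])
  moreover have "(2::nat) ^ (Suc h + 1) div 2 = 2 ^ Suc h" "(2::nat) ^ (Suc h + 1) div 4 = 2 ^ h" by simp_all
  moreover have "odd (Suc h) \<and> Suc h \<ge> 3 \<longleftrightarrow> even h \<and> h \<ge> 2" by auto
  ultimately show ?thesis
    by (cases "even h \<and> h \<ge> 2") (simp_all only: algA_index.simps Let_def join_def[abs_def] if_True if_False nat.distinct id_comp simp_thms)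
qed

text \<open>
  At even height there is no exchange, so the root sits exactly in the middle, and the end of the left
  half still looks as in the left subtree.  This is what the exchange at the next odd height relies on.
\<close>
lemma algA_invariant:
  assumes "binary_regular_tree h t"
  shows "layout h t (algA_index t) \<and> half_cost h (algA_index t) t = alg_cost h \<and>
    (even h \<longrightarrow> algA_index t (value t) = 2 ^ h \<and> (h \<ge> 2 \<longrightarrow> pendant_before t (algA_index t) (2 ^ h)))"
  using assms
proof (induction rule: binary_regular_tree_induct)
  case (single v)
  then show ?case by (auto simp: layout_def half_cost_def parcs_single)
next
  case (node h l v r)
  let ?a = "join (2 ^ Suc h) v (set_tree l) (algA_index l) (algA_index r)"
  note lr = node.hyps(1-5)
  have lay: "layout h l (algA_index l)" "layout h r (algA_index r)" using node.IH by auto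
  have cost: "half_cost (Suc h) ?a \<langle>l, v, r\<rangle> = 2 * alg_cost h + 2 * h + 3"
    unfolding layout_join(2)[OF lr lay] using node.IH by simp
  show ?case
  proof (cases "even h \<and> h \<ge> 2")
    case True
    then have "algA_index l (value l) = 2 ^ h" "pendant_before l (algA_index l) (2 ^ h)"
      using node.IH by auto
    moreover have "algA_index \<langle>l, v, r\<rangle> = transpose (2 ^ h - 1) (2 ^ Suc h) \<circ> ?a"
      using algA_index_Node[OF node.hyps(1)] True by (simp only: if_True simp_thms)
    moreover have "half_cost (Suc h) (transpose (2 ^ h - 1) (2 ^ Suc h) \<circ> ?a) \<langle>l, v, r\<rangle> = alg_cost (Suc h)"
      using layout_exchange(2)[OF lr lay] cost True calculation(1,2) by simp
    ultimately show ?thesis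
      using layout_exchange(1)[OF lr lay] True by (simp only: even_Suc) blast
  next
    case False
    have "pendant_before \<langle>l, v, r\<rangle> ?a (2 ^ Suc h)" if "odd h"
    proof -
      have "pendant_before l (algA_index l) (2 ^ Suc h)"
        using lay(1) that unfolding layout_def by (cases h) auto
      then show ?thesis using pendant_before_Node(1)[OF lr] join_simps(2)[OF lr(3-5)] by blast
    qed
    moreover have "algA_index \<langle>l, v, r\<rangle> = ?a"
      using algA_index_Node[OF node.hyps(1)] False by (simp only: if_False id_comp)
    ultimately show ?thesis
      using layout_join(1)[OF lr lay] cost False join_simps(1)[OF lr(3-5)] by auto
  qed
qed

section \<open>Comparison of the two bounds\<close>

text \<open>
  The first two terms are exact, \<open>1 / 3 + 1 / 7 = 64 / 105 - 2 / 15\<close>.  From \<open>j = 3\<close> on, \<open>2 ^ Suc j\<close> is at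
  least 16, so that the terms are at most \<open>16 / 15\<close> times those of a geometric series, whose tail is
  kept on the left-hand side to make the induction work.  Using the geometric series from \<open>j = 2\<close> on
  would give only \<open>13 / 21\<close>, for which the leading coefficients of the two costs have ratio exactly
  \<open>203 / 200\<close> and the terms of lower order spoil the estimate.
\<close>
lemma sum_inverse_Mersenne_bound:
  assumes "n \<ge> 2"
  shows "(\<Sum>j\<in>{1..n}. 1 / (2 ^ Suc j - 1)) + (16 / 15) / 2 ^ Suc n \<le> (64 / 105 :: real)"
  using assms
proof (induction n rule: nat_induct_at_least)
  case base
  have "{1..2::nat} = {1, 2}" by auto
  then show ?case by (simp add: field_simps)
next
  case (Suc n)
  have "(2::real) ^ 4 \<le> 2 ^ Suc (Suc n)" using Suc.hyps by (intro power_increasing) auto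
  then have "1 / (2 ^ Suc (Suc n) - 1) \<le> (16 / 15) / (2::real) ^ Suc (Suc n)"
    by (simp add: divide_simps)
  moreover have "(16 / 15) / (2::real) ^ Suc n = 2 * ((16 / 15) / 2 ^ Suc (Suc n))" by simp
  ultimately show ?case using Suc.IH by (simp only: sum.cl_ivl_Suc) auto
qed

text \<open>
  With the bound above, \<open>406\<close> times the lower bound for half the objective value minus
  \<open>400 * c\<close> is at least \<open>2 * (58 / 15 * 2 ^ h - 6 h - 135)\<close>, which is positive from \<open>h = 6\<close> on.
\<close>
lemma approximation_ratio:
  fixes h c L :: nat
  defines "D \<equiv> \<Sum>j\<in>{1..h}. 2 ^ Suc h div (2 ^ Suc j - 1)"
  assumes h: "1 \<le> h" and c: "6 * c + 12 * h + (if odd h then 28 else 26) = 29 * 2 ^ h"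
    and L: "2 * (6 * 2 ^ h) \<le> L + 2 * (6 + 2 * h + D)"
  shows "200 * (2 * c) \<le> 203 * L"
proof (cases "h \<ge> 6")
  case True
  have "real (2 ^ Suc h div (2 ^ Suc j - 1)) \<le> 2 ^ Suc h * (1 / (2 ^ Suc j - 1))" for j
  proof -
    have "real (2 ^ Suc j - 1) = 2 ^ Suc j - 1" by (simp add: of_nat_diff)
    then show ?thesis using of_nat_div_le_of_nat[of "2 ^ Suc h" "2 ^ Suc j - 1", where ?'a = real] by simp
  qed
  then have "real D \<le> 2 ^ Suc h * (\<Sum>j\<in>{1..h}. 1 / (2 ^ Suc j - 1))"
    unfolding D_def of_nat_sum sum_distrib_left by (intro sum_mono) auto
  also have "\<dots> \<le> 2 ^ Suc h * (64 / 105 - (16 / 15) / 2 ^ Suc h)"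
    using sum_inverse_Mersenne_bound[of h] True by (intro mult_left_mono) auto
  finally have "real D \<le> 128 / 105 * 2 ^ h - 16 / 15" by (simp add: algebra_simps)
  moreover have "real (2 * (6 * 2 ^ h)) \<le> real (L + 2 * (6 + 2 * h + D))" using L by (simp only: of_nat_le_iff)
  moreover have "real (6 * c + 12 * h + 26) \<le> real (29 * 2 ^ h)"
    unfolding of_nat_le_iff using c by (simp split: if_splits)
  moreover have "2 * h + 52 \<le> 2 ^ h"
    using True by (induction h rule: nat_induct_at_least) auto
  then have "real (2 * h + 52) \<le> real (2 ^ h)" by (simp only: of_nat_le_iff)
  ultimately have "400 * real c \<le> 203 * real L" by simp
  then show ?thesis by linarith
next
  case False
  then consider "h = 1" | "h = 2" | "h = 3" | "h = 4" | "h = 5" using h by linarith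
  moreover have "{1..2::nat} = {1, 2}" "{1..3::nat} = {1, 2, 3}" "{1..4::nat} = {1, 2, 3, 4}"
    "{1..5::nat} = {1, 2, 3, 4, 5}" by auto
  ultimately show ?thesis
    using c L unfolding D_def by cases simp_all
qed

lemma algA_arrangement:
  assumes G: "binary_regular_tree h G" and T: "binary_regular_tree (Suc h) T"
  shows "arrangement G T (algA G T)" and "OV G T (algA G T) = 2 * alg_cost h"
proof -
  let ?a = "algA_index G"
  have a: "inj_on ?a (set_tree G)" "?a ` set_tree G \<subseteq> {1..<2 ^ Suc h}" "half_cost h ?a G = alg_cost h"
    using algA_invariant[OF G] by (auto simp: layout_def)
  have p: "?a x - 1 < 2 ^ Suc h \<and> algA G T x = leaves T ! (?a x - 1)" "1 \<le> ?a x" if "x \<in> set_tree G" for x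
  proof -
    have "?a x \<in> {1..<2 ^ Suc h}" using a(2) that by blast
    then show "?a x - 1 < 2 ^ Suc h \<and> algA G T x = leaves T ! (?a x - 1)" "1 \<le> ?a x"
      by (auto simp: algA_def nth_leaf_def)
  qed
  have "inj_on (algA G T) (set_tree G)"
  proof (rule inj_onI)
    fix x y assume xy: "x \<in> set_tree G" "y \<in> set_tree G" "algA G T x = algA G T y"
    then have "?a x - 1 = ?a y - 1"
      using p(1)[OF xy(1)] p(1)[OF xy(2)] leaves_regular[OF T] by (metis nth_eq_iff_index_eq)
    then have "?a x = ?a y" using p(2)[OF xy(1)] p(2)[OF xy(2)] by linarith
    then show "x = y" using a(1) xy by (simp add: inj_on_eq_iff)
  qed
  moreover have "algA G T x \<in> set (leaves T)" if "x \<in> set_tree G" for x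
    using p(1)[OF that] leaves_regular(1)[OF T] by simp
  ultimately show "arrangement G T (algA G T)" by (auto simp: arrangement_def)
  have "OV G T (algA G T) = 2 * half_cost h ?a G"
    unfolding half_cost_def by (rule OV_positions[OF T p(1)])
  then show "OV G T (algA G T) = 2 * alg_cost h" unfolding a(3) .
qed

theorem theorem23:
  fixes G :: "'a tree" and T :: "'b tree" and hG :: nat and \<phi>opt :: "'a \<Rightarrow> 'b"
  assumes "hG \<ge> 1"
    and "binary_regular_tree hG G"
    and "binary_regular_tree (hG + 1) T"
    and "optimal_arrangement G T \<phi>opt"
  shows "arrangement G T (algA G T) \<and>
         real (OV G T (algA G T)) \<le> 203 / 200 * real (OV G T \<phi>opt)"
proof -
  have T: "binary_regular_tree (Suc hG) T" using assms(3) by simp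
  have "arrangement G T \<phi>opt"
    using assms(4) by (simp add: optimal_arrangement_def is_arg_min_def)
  then have "200 * OV G T (algA G T) \<le> 203 * OV G T \<phi>opt"
    unfolding algA_arrangement(2)[OF assms(2) T]
    using approximation_ratio[OF assms(1) alg_cost_closed_form[OF assms(1)]]
      OV_lower_bound[OF assms(2) T] by blast
  then show ?thesis using algA_arrangement(1)[OF assms(2) T] by linarith
qed

end
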